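(* Consider a global $C^1$ solution $(f^\alpha, E_1,E_2,B)$, $t\ge 0$, of the relativistic Vlasov-Maxwell system with initial data as described in the context. (i) In the neutral case there is a constant $C$ (independent of $t,x,v$) such that, for every $\alpha$, $$|v_2|\le C+C\sqrt{t-|x|+C_0}$$ for all $(t,x,v)$ in the support of $f^\alpha$ (with $t\ge0$). (ii) In the monocharge case there is a positive constant $C$ (independent of $t,x,v$) such that $$|v_2|\le C+C\sqrt{(t+C_0)^2-x^2}$$ for all $(t,x,v)$ in the support of $f$ (with $t\ge 0$).
   Context: The system, for $\alpha=1,\dots,N$, $t\ge0$, $x\in\mathbb{R}$, $v=(v_1,v_2)\in\mathbb{R}^2$, is $$\partial_t f^\alpha+\hat v_1^\alpha\partial_x f^\alpha+e^\alpha(E_1+\hat v_2^\alpha B)\partial_{v_1}f^\alpha+e^\alpha(E_2-\hat v_1^\alpha B)\partial_{v_2}f^\alpha=0,$$ $$\rho(t,x)=\int\sum_\alpha e^\alpha f^\alpha(t,x,v)\,dv,\qquad j(t,x)=\int\sum_\alpha e^\alpha f^\alpha(t,x,v)\hat v^\alpha\,dv,$$ $$E_1(t,x)=\tfrac12\int_{-\infty}^x\rho(t,y)\,dy-\tfrac12\int_x^\infty\rho(t,y)\,dy,\qquad \partial_tE_2+\partial_xB=-j_2,\qquad \partial_tB+\partial_xE_2=0,$$ where $\hat v^\alpha=v/\sqrt{(m^\alpha)^2+|v|^2}$, $m^\alpha>0$ is the mass and $e^\alpha\in\mathbb{R}$ the charge of species $\alpha$; $v$-integrals are over $\mathbb{R}^2$.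 Initial data: $f^\alpha(0,x,v)=f_0^\alpha(x,v)\ge0$, $E_2(0,x)=E_{20}(x)$, $B(0,x)=B_0(x)$, where $f_0^\alpha\in C_0^1(\mathbb{R}^3)$ is nonnegative and compactly supported and $E_{20},B_0\in C^1_0(\mathbb{R})$ are compactly supported. $C_0>0$ is chosen so that $f_0^\alpha$ (for all $\alpha$), $E_{20}$ and $B_0$ vanish if $|x|\ge C_0$. The neutral case means $\iint\sum_\alpha e^\alpha f_0^\alpha\,dv\,dx=0$. The monocharge case means $N=1$, $e^1=1$, $m^1=1$, and then one writes $f=f^1$. Constants $C$ may depend on the initial data (and the fixed parameters of the system) but not on $t,x,v$. (Since particle speeds are less than $1$, $|x|\le C_0+t$ on the support of $f^\alpha$, so the square roots are defined.) *)

theory Defs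
  imports "HOL-Analysis.Analysis"
begin

(* The velocity space R^2 is "real \<times> real", whose library norm is the Euclidean norm.
   The species are indexed by {1..N}; values of families at other indices are irrelevant. *)

text \<open>
  For a half-space such as \<open>{0..} \<times> UNIV\<close> the derivative within the set is one-sided in the
  first variable at the boundary, and it is uniquely determined there.
\<close>
definition C1_on :: "'a::real_normed_vector set \<Rightarrow> ('a \<Rightarrow> 'b::real_normed_vector) \<Rightarrow> bool" where
  "C1_on S f \<longleftrightarrow>
     (\<exists>f'. (\<forall>z\<in>S. (f has_derivative blinfun_apply (f' z)) (at z within S)) \<and> continuous_on S f')"

definition C1_compact_support :: "('a::real_normed_vector \<Rightarrow> 'b::real_normed_vector) \<Rightarrow> bool" where
  "C1_compact_support f \<longleftrightarrow> C1_on UNIV f \<and> compact (closure {z. f z \<noteq> 0})"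

definition vhat :: "real \<Rightarrow> real \<times> real \<Rightarrow> real \<times> real" where
  "vhat m v = v /\<^sub>R sqrt (m\<^sup>2 + (norm v)\<^sup>2)"

definition charge_density ::
  "nat \<Rightarrow> (nat \<Rightarrow> real) \<Rightarrow> (nat \<Rightarrow> real \<Rightarrow> real \<Rightarrow> real \<times> real \<Rightarrow> real) \<Rightarrow> real \<Rightarrow> real \<Rightarrow> real" where
  "charge_density N e f t x = (\<integral>v. (\<Sum>\<alpha>=1..N. e \<alpha> * f \<alpha> t x v) \<partial>lborel)"

definition current_density ::
  "nat \<Rightarrow> (nat \<Rightarrow> real) \<Rightarrow> (nat \<Rightarrow> real) \<Rightarrow> (nat \<Rightarrow> real \<Rightarrow> real \<Rightarrow> real \<times> real \<Rightarrow> real)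
    \<Rightarrow> real \<Rightarrow> real \<Rightarrow> real \<times> real" where
  "current_density N m e f t x =
     (\<integral>v. (\<Sum>\<alpha>=1..N. (e \<alpha> * f \<alpha> t x v) *\<^sub>R vhat (m \<alpha>) v) \<partial>lborel)"

definition admissible_data ::
  "nat \<Rightarrow> (nat \<Rightarrow> real \<Rightarrow> real \<times> real \<Rightarrow> real) \<Rightarrow> (real \<Rightarrow> real) \<Rightarrow> (real \<Rightarrow> real) \<Rightarrow> real \<Rightarrow> bool" where
  "admissible_data N f0 E20 B0 C0 \<longleftrightarrow>
     (\<forall>\<alpha>\<in>{1..N}. C1_compact_support (\<lambda>(x, v). f0 \<alpha> x v) \<and> (\<forall>x v. 0 \<le> f0 \<alpha> x v)) \<and>
     C1_compact_support E20 \<and> C1_compact_support B0 \<and>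
     C0 > 0 \<and>
     (\<forall>x. \<bar>x\<bar> \<ge> C0 \<longrightarrow> (\<forall>\<alpha>\<in>{1..N}. \<forall>v. f0 \<alpha> x v = 0) \<and> E20 x = 0 \<and> B0 x = 0)"

text \<open>
  Functions of time are total on \<open>real\<close>, but only their values at times \<open>t \<ge> 0\<close> matter. In
  particular time derivatives are taken within \<open>{0..}\<close>, hence one-sided at \<open>t = 0\<close>. All the
  derivatives written below exist because of the C1 requirements. No integrability is required
  separately: \<open>f \<alpha>\<close> is constant along the characteristics, so it has compact support in
  \<open>(x, v)\<close>, uniformly for \<open>t\<close> in bounded intervals.
\<close>
definition RVM_solution ::
  "nat \<Rightarrow> (nat \<Rightarrow> real) \<Rightarrow> (nat \<Rightarrow> real) \<Rightarrow>
   (nat \<Rightarrow> real \<Rightarrow> real \<times> real \<Rightarrow> real) \<Rightarrow> (real \<Rightarrow> real) \<Rightarrow> (real \<Rightarrow> real) \<Rightarrow>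
   (nat \<Rightarrow> real \<Rightarrow> real \<Rightarrow> real \<times> real \<Rightarrow> real) \<Rightarrow>
   (real \<Rightarrow> real \<Rightarrow> real) \<Rightarrow> (real \<Rightarrow> real \<Rightarrow> real) \<Rightarrow> (real \<Rightarrow> real \<Rightarrow> real) \<Rightarrow> bool" where
  "RVM_solution N m e f0 E20 B0 f E1 E2 B \<longleftrightarrow>
     (\<forall>\<alpha>\<in>{1..N}. C1_on ({0..} \<times> UNIV) (\<lambda>(t, x, v). f \<alpha> t x v)) \<and>
     C1_on ({0..} \<times> UNIV) (\<lambda>(t, x). E1 t x) \<and>
     C1_on ({0..} \<times> UNIV) (\<lambda>(t, x). E2 t x) \<and>
     C1_on ({0..} \<times> UNIV) (\<lambda>(t, x). B t x) \<and>
     (\<forall>\<alpha>\<in>{1..N}. \<forall>t\<ge>0. \<forall>x v1 v2.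
        vector_derivative (\<lambda>s. f \<alpha> s x (v1, v2)) (at t within {0..})
        + fst (vhat (m \<alpha>) (v1, v2)) * deriv (\<lambda>y. f \<alpha> t y (v1, v2)) x
        + e \<alpha> * (E1 t x + snd (vhat (m \<alpha>) (v1, v2)) * B t x) * deriv (\<lambda>w. f \<alpha> t x (w, v2)) v1
        + e \<alpha> * (E2 t x - fst (vhat (m \<alpha>) (v1, v2)) * B t x) * deriv (\<lambda>w. f \<alpha> t x (v1, w)) v2
        = 0) \<and>
     (\<forall>t\<ge>0. \<forall>x.
        E1 t x = 1/2 * (LBINT y:{..x}. charge_density N e f t y)
               - 1/2 * (LBINT y:{x..}. charge_density N e f t y)) \<and>
     (\<forall>t\<ge>0. \<forall>x.
        vector_derivative (\<lambda>s. E2 s x) (at t within {0..}) + deriv (\<lambda>y. B t y) x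
        = - snd (current_density N m e f t x)) \<and>
     (\<forall>t\<ge>0. \<forall>x.
        vector_derivative (\<lambda>s. B s x) (at t within {0..}) + deriv (\<lambda>y. E2 t y) x = 0) \<and>
     (\<forall>\<alpha>\<in>{1..N}. \<forall>x v. f \<alpha> 0 x v = f0 \<alpha> x v) \<and>
     (\<forall>x. E2 0 x = E20 x) \<and> (\<forall>x. B 0 x = B0 x)"

definition phase_support ::
  "(real \<Rightarrow> real \<Rightarrow> real \<times> real \<Rightarrow> real) \<Rightarrow> (real \<times> real \<times> (real \<times> real)) set" where
  "phase_support g = closure {(t, x, v). t \<ge> 0 \<and> g t x v \<noteq> 0}"

definition neutral_data ::
  "nat \<Rightarrow> (nat \<Rightarrow> real) \<Rightarrow> (nat \<Rightarrow> real \<Rightarrow> real \<times> real \<Rightarrow> real) \<Rightarrow> bool" where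
  "neutral_data N e f0 \<longleftrightarrow>
     (\<integral>x. (\<integral>v. (\<Sum>\<alpha>=1..N. e \<alpha> * f0 \<alpha> x v) \<partial>lborel) \<partial>lborel) = 0"

definition monocharge :: "nat \<Rightarrow> (nat \<Rightarrow> real) \<Rightarrow> (nat \<Rightarrow> real) \<Rightarrow> bool" where
  "monocharge N m e \<longleftrightarrow> N = 1 \<and> e 1 = 1 \<and> m 1 = 1"

end

theory Submission
  imports Defs
begin

text \<open>
  The second momentum component is controlled by a potential. Since
  \<open>\<partial>\<^sub>t B + \<partial>\<^sub>x E2 = 0\<close>, the function \<open>A(t, x) = \<integral>\<^sub>-\<^sub>\<infinity>\<^sup>x B(t, y) dy\<close> satisfies \<open>\<partial>\<^sub>x A = B\<close> and
  \<open>\<partial>\<^sub>t A = - E2\<close>, so the canonical momentum \<open>v\<^sub>2 + e A(t, x)\<close> is transported by the Vlasov equation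
  (lemma \<open>canonical_momentum_bound\<close>). On the support of \<open>f\<close> it is therefore bounded by its initial values, and
  \<open>\<bar>v\<^sub>2\<bar> \<le> C + \<bar>e\<bar> \<bar>A(t, x)\<bar>\<close>.

  To bound \<open>A\<close>, note that everything propagates with speed at most one, so that \<open>f\<close>, \<open>E2\<close> and \<open>B\<close> vanish
  for \<open>\<bar>x\<bar> \<ge> C0 + t\<close>. Hence \<open>A = 0\<close> to the left of this cone, and to its right \<open>A\<close> keeps its
  initial value. Integrating \<open>B\<close> from the nearer edge of the cone to \<open>x\<close>, the Cauchy-Schwarz inequality gives
  \<open>\<bar>A(t, x)\<bar> \<le> C + sqrt ((C0 + t - \<bar>x\<bar>) * \<integral> B\<^sup>2 dx)\<close> (lemma \<open>potential_bound\<close>).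

  Finally \<open>\<integral> B\<^sup>2 dx\<close> is at most twice the energy. With \<open>R = C0 + t\<close>, the energy contained in the fixed interval
  \<open>[-R, R]\<close> is constant up to time \<open>t\<close>, because neither particles nor radiation reach its ends
  (lemma \<open>energy_conserved\<close>). Initially it is at most \<open>K + R S\<^sup>2\<close>, where \<open>S\<close> bounds
  \<open>E1(0, x)\<close>. For neutral data \<open>E1(0, x)\<close> vanishes for \<open>\<bar>x\<bar> \<ge> C0\<close>, the energy is bounded
  independently of \<open>t\<close>, and the first estimate follows. In the monocharge case the energy may grow, but at most like a
  multiple of \<open>C0 + t\<close>, and
  \<open>(C0 + t - \<bar>x\<bar>) (C0 + t) \<le> (C0 + t)\<^sup>2 - x\<^sup>2\<close> gives the second.

  In place of an integration along characteristic curves, all facts about the transport of \<open>f\<close> (its sign, its finite speed of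
  propagation, its bounded velocity support and the conservation of canonical momentum) come from a maximum principle on
  backward cones, \<open>backward_cone_comparison\<close>.
\<close>

section \<open>Continuously differentiable functions on a half-space\<close>

text \<open>
  A name for the derivative whose existence \<open>C1_on\<close> asserts; it is one-sided in time at \<open>t = 0\<close>.
\<close>
definition half_deriv ::
  "(real \<times> 'a::real_normed_vector \<Rightarrow> 'b::real_normed_vector) \<Rightarrow> real \<times> 'a \<Rightarrow> (real \<times> 'a) \<Rightarrow>\<^sub>L 'b" where
  "half_deriv F = (SOME F'. (\<forall>z\<in>{0..} \<times> UNIV. (F has_derivative blinfun_apply (F' z)) (at z within {0..} \<times> UNIV))
     \<and> continuous_on ({0..} \<times> UNIV) F')"

lemma half_deriv:
  assumes "C1_on ({0..} \<times> UNIV) F"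
  shows "0 \<le> t \<Longrightarrow> (F has_derivative blinfun_apply (half_deriv F (t, y))) (at (t, y) within {0..} \<times> UNIV)"
    and "continuous_on ({0..} \<times> UNIV) (half_deriv F)"
proof -
  have "(\<forall>z\<in>{0..} \<times> UNIV. (F has_derivative blinfun_apply (half_deriv F z)) (at z within {0..} \<times> UNIV))
     \<and> continuous_on ({0..} \<times> UNIV) (half_deriv F)"
    unfolding half_deriv_def
    by (rule someI_ex[where P = "\<lambda>F'. (\<forall>z\<in>{0..} \<times> UNIV. (F has_derivative blinfun_apply (F' z)) (at z within {0..} \<times> UNIV))
     \<and> continuous_on ({0..} \<times> UNIV) F'"]) (use assms in \<open>simp add: C1_on_def\<close>)
  then show "0 \<le> t \<Longrightarrow> (F has_derivative blinfun_apply (half_deriv F (t, y))) (at (t, y) within {0..} \<times> UNIV)"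
    and "continuous_on ({0..} \<times> UNIV) (half_deriv F)" by auto
qed

lemma C1_on_continuous:
  assumes "C1_on ({0..} \<times> UNIV) F"
  shows "continuous_on ({0..} \<times> UNIV) F"
  unfolding continuous_on_eq_continuous_within
  using assms by (force simp: C1_on_def intro: has_derivative_continuous)

lemma half_deriv_direction:
  assumes "C1_on ({0..} \<times> UNIV) F" "0 \<le> t"
  shows "((\<lambda>s. F (s, y + s *\<^sub>R k)) has_vector_derivative half_deriv F (t, y + t *\<^sub>R k) (1, k)) (at t within {0..})"
proof -
  let ?D = "half_deriv F (t, y + t *\<^sub>R k)"
  have "((\<lambda>s. F (s, y + s *\<^sub>R k)) has_derivative (\<lambda>h. ?D (h, h *\<^sub>R k))) (at t within {0..})"
    by (rule has_derivative_in_compose2[where g = F and t = "{0..} \<times> UNIV" and f = "\<lambda>s. (s, y + s *\<^sub>R k)"])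
       (use half_deriv(1)[OF assms(1)] assms(2) in \<open>auto intro!: derivative_eq_intros\<close>)
  moreover have "(\<lambda>h. ?D (h, h *\<^sub>R k)) = (\<lambda>h. h *\<^sub>R ?D (1, k))"
    by (simp flip: blinfun.scaleR_right)
  ultimately show ?thesis by (simp add: has_vector_derivative_def)
qed

lemma half_deriv_time:
  assumes "C1_on ({0..} \<times> UNIV) F" "0 \<le> t"
  shows "((\<lambda>s. F (s, y)) has_vector_derivative half_deriv F (t, y) (1, 0)) (at t within {0..})"
  using half_deriv_direction[OF assms, of y 0] by simp

lemma half_deriv_space:
  assumes "C1_on ({0..} \<times> UNIV) F" "0 \<le> t"
  shows "((\<lambda>y. F (t, y)) has_derivative (\<lambda>k. half_deriv F (t, y) (0, k))) (at y)"
proof -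
  have "((\<lambda>y. F (t, y)) has_derivative (\<lambda>h. half_deriv F (t, y) (0, h))) (at y within UNIV)"
    by (rule has_derivative_in_compose2[where g = F and t = "{0..} \<times> UNIV" and f = "\<lambda>y. (t, y)"])
       (use half_deriv(1)[OF assms(1)] assms(2) in \<open>auto intro!: derivative_eq_intros\<close>)
  then show ?thesis by simp
qed

lemma half_deriv_line:
  assumes "C1_on ({0..} \<times> UNIV) F" "0 \<le> t"
  shows "((\<lambda>h. F (t, y + h *\<^sub>R k)) has_vector_derivative half_deriv F (t, y + h0 *\<^sub>R k) (0, k)) (at h0)"
proof -
  let ?D = "half_deriv F (t, y + h0 *\<^sub>R k)"
  have "((\<lambda>h. F (t, y + h *\<^sub>R k)) has_derivative (\<lambda>h. ?D (0, h *\<^sub>R k))) (at h0)"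
    by (rule has_derivative_compose[where g = "\<lambda>y. F (t, y)" and f = "\<lambda>h. y + h *\<^sub>R k", unfolded o_def])
       (use half_deriv_space[OF assms] in \<open>auto intro!: derivative_eq_intros\<close>)
  moreover have "(\<lambda>h. ?D (0, h *\<^sub>R k)) = (\<lambda>h. h *\<^sub>R ?D (0, k))"
    by (simp flip: blinfun.scaleR_right)
  ultimately show ?thesis by (simp add: has_vector_derivative_def)
qed

lemma continuous_on_half_deriv:
  assumes "C1_on ({0..} \<times> UNIV) F" "continuous_on S g" "\<And>s. s \<in> S \<Longrightarrow> 0 \<le> fst (g s)"
  shows "continuous_on S (\<lambda>s. half_deriv F (g s) k)"
  by (intro continuous_intros continuous_on_compose2[OF half_deriv(2)[OF assms(1)] assms(2)])
     (use assms(3) in \<open>auto simp: mem_Times_iff image_subset_iff\<close>)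

lemma continuous_on_C1:
  assumes "C1_on ({0..} \<times> UNIV) F" "continuous_on S g" "\<And>s. s \<in> S \<Longrightarrow> 0 \<le> fst (g s)"
  shows "continuous_on S (\<lambda>s. F (g s))"
  by (intro continuous_on_compose2[OF C1_on_continuous[OF assms(1)] assms(2)])
     (use assms(3) in \<open>auto simp: mem_Times_iff image_subset_iff\<close>)

lemma vector_derivative_half_line:
  fixes t :: real
  assumes "(g has_vector_derivative d) (at t within {0..})" "0 \<le> t"
  shows "vector_derivative g (at t within {0..}) = d"
proof (rule vector_derivative_within[OF _ assms(1)])
  have "at t within {0..} \<ge> at_right t"
    using assms(2) by (intro at_le) auto
  then show "at t within {0..} \<noteq> bot"
    by (metis bot.extremum_uniqueI trivial_limit_at_right_real)
qed

section \<open>A comparison principle on backward cones\<close>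

text \<open>
  A maximum principle that replaces integration along characteristics. Suppose that \<open>F (T, x, v) > 0\<close> and subtract
  \<open>\<epsilon> s\<close> with a small \<open>\<epsilon> > 0\<close>. The maximum over the compact backward cone is still positive, so it is not attained at
  \<open>s = 0\<close>. From a maximum point one can move backwards along \<open>(1, a, b)\<close> without leaving the cone,
  and this increases the function at a rate of at least \<open>\<epsilon>\<close>.
\<close>
lemma backward_cone_comparison:
  fixes F :: "real \<times> 'a::euclidean_space \<times> 'b::euclidean_space \<Rightarrow> real"
  assumes T: "0 \<le> T" and K: "0 \<le> K"
    and deriv: "\<And>s y w. 0 \<le> s \<Longrightarrow> s \<le> T \<Longrightarrow> dist x y \<le> T - s \<Longrightarrow> dist v w \<le> K * (T - s) \<Longrightarrow>
      \<exists>D a b. (F has_derivative D) (at (s, y, w) within {0..} \<times> UNIV)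
        \<and> norm a \<le> 1 \<and> norm b \<le> K \<and> D (1, a, b) \<le> 0"
    and init: "\<And>y w. dist x y \<le> T \<Longrightarrow> dist v w \<le> K * T \<Longrightarrow> F (0, y, w) \<le> 0"
  shows "F (T, x, v) \<le> 0"
proof (rule ccontr)
  assume "\<not> F (T, x, v) \<le> 0"
  then have pos: "F (T, x, v) > 0" by simp
  define \<epsilon> where "\<epsilon> = F (T, x, v) / (2 * (T + 1))"
  have eps: "\<epsilon> > 0" "F (T, x, v) - \<epsilon> * T > 0"
    using pos T by (auto simp: \<epsilon>_def field_simps intro: add_nonneg_pos)
  define Z where "Z = {(s, y, w). 0 \<le> s \<and> s \<le> T \<and> dist x y \<le> T - s \<and> dist v w \<le> K * (T - s)}"
  have subZ: "Z \<subseteq> {0..} \<times> UNIV" by (auto simp: Z_def)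
  have "Z \<subseteq> {0..T} \<times> cball x T \<times> cball v (K * T)"
  proof safe
    fix s y w assume "(s, y, w) \<in> Z"
    moreover have "K * (T - s) \<le> K * T" if "0 \<le> s" using K that by (simp add: mult_left_mono)
    ultimately show "s \<in> {0..T}" "y \<in> cball x T" "w \<in> cball v (K * T)"
      by (force simp: Z_def)+
  qed
  moreover have "bounded ({0..T} \<times> cball x T \<times> cball v (K * T))"
    by (intro bounded_Times) auto
  moreover have "closed Z"
    unfolding Z_def split_beta'
    by (intro closed_Collect_conj closed_Collect_le continuous_intros)
  ultimately have "compact Z" by (meson bounded_subset compact_eq_bounded_closed)
  moreover have "continuous_on Z (\<lambda>z. F z - \<epsilon> * fst z)"
  proof (intro continuous_intros)
    show "continuous_on Z F"
      unfolding continuous_on_eq_continuous_within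
    proof safe
      fix s y w assume z: "(s, y, w) \<in> Z"
      then obtain D where "(F has_derivative D) (at (s, y, w) within {0..} \<times> UNIV)"
        using deriv[of s y w] by (auto simp: Z_def)
      then show "continuous (at (s, y, w) within Z) F"
        by (rule continuous_within_subset[OF has_derivative_continuous subZ])
    qed
  qed
  moreover have "(T, x, v) \<in> Z" using T by (auto simp: Z_def)
  ultimately obtain z where z: "z \<in> Z" and zmax: "\<And>z'. z' \<in> Z \<Longrightarrow> F z' - \<epsilon> * fst z' \<le> F z - \<epsilon> * fst z"
    using continuous_attains_sup[of Z "\<lambda>z. F z - \<epsilon> * fst z"] by blast
  obtain s y w where zz: "z = (s, y, w)" by (cases z)
  have c: "0 \<le> s" "s \<le> T" "dist x y \<le> T - s" "dist v w \<le> K * (T - s)"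
    using z by (auto simp: zz Z_def)
  have "F z - \<epsilon> * s > 0" using zmax[OF \<open>(T, x, v) \<in> Z\<close>] eps(2) by (simp add: zz)
  then have s: "s > 0" using init[of y w] c by (cases "s = 0") (auto simp: zz)
  obtain D a b where D: "(F has_derivative D) (at (s, y, w) within {0..} \<times> UNIV)"
    and ab: "norm a \<le> 1" "norm b \<le> K" and D0: "D (1, a, b) \<le> 0"
    using deriv[OF c] by blast
  define p where "p = (\<lambda>h. (s - h, y - h *\<^sub>R a, w - h *\<^sub>R b))"
  have p0: "p 0 = (s, y, w)" by (simp add: p_def)
  have "((\<lambda>h. F (p h)) has_derivative (\<lambda>h. D (- h, - h *\<^sub>R a, - h *\<^sub>R b))) (at 0 within {0..s})"
    by (rule has_derivative_in_compose[where g = F and f = p])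
       (use D in \<open>auto simp: p_def intro!: derivative_eq_intros has_derivative_subset[of F D _ "{0..} \<times> UNIV"]\<close>)
  moreover have "(\<lambda>h. D (- h, - h *\<^sub>R a, - h *\<^sub>R b)) = (*) (- D (1, a, b))"
    using linear_cmul[OF has_derivative_linear[OF D], of "- h" "(1, a, b)" for h]
    by (auto simp: fun_eq_iff mult.commute)
  ultimately have "((\<lambda>h. F (p h)) has_real_derivative - D (1, a, b)) (at 0 within {0..s})"
    by (simp add: has_field_derivative_def)
  then have "((\<lambda>h. F (p h) - \<epsilon> * (s - h)) has_real_derivative - D (1, a, b) + \<epsilon>) (at 0 within {0..s})"
    by (auto intro!: derivative_eq_intros)
  from has_real_derivative_pos_inc_right[OF this] D0 eps(1)
  obtain d where d: "d > 0"
    "\<And>h. 0 < h \<Longrightarrow> 0 + h \<in> {0..s} \<Longrightarrow> h < d \<Longrightarrow> F (p 0) - \<epsilon> * (s - 0) < F (p (0 + h)) - \<epsilon> * (s - (0 + h))"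
    by auto
  define h where "h = min (d / 2) s"
  have h: "0 < h" "h \<le> s" "h < d" using d(1) s by (auto simp: h_def)
  \<comment> \<open>The speed bounds keep the backward characteristic direction inside the cone.\<close>
  have "dist x (y - h *\<^sub>R a) \<le> dist x y + h * norm a"
    using norm_triangle_ineq[of "x - y" "h *\<^sub>R a"] h by (simp add: dist_norm algebra_simps)
  also have "\<dots> \<le> (T - s) + h * 1" using c ab h by (intro add_mono mult_left_mono) auto
  finally have 1: "dist x (y - h *\<^sub>R a) \<le> T - (s - h)" by simp
  have "dist v (w - h *\<^sub>R b) \<le> dist v w + h * norm b"
    using norm_triangle_ineq[of "v - w" "h *\<^sub>R b"] h by (simp add: dist_norm algebra_simps)
  also have "\<dots> \<le> K * (T - s) + h * K" using c ab h by (intro add_mono mult_left_mono) auto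
  finally have 2: "dist v (w - h *\<^sub>R b) \<le> K * (T - (s - h))" by (simp add: algebra_simps)
  have "p h \<in> Z" using 1 2 h c by (auto simp: Z_def p_def)
  from zmax[OF this] d(2)[of h] h show False by (simp add: p_def zz)
qed

section \<open>Integrals over boxes\<close>

text \<open>
  This is the statement that the variance of \<open>g\<close> is nonnegative, that is,
  \<open>\<integral> ((b - a) g - \<integral> g)\<^sup>2 \<ge> 0\<close>.
\<close>
lemma integral_square_Cauchy_Schwarz:
  fixes g :: "real \<Rightarrow> real"
  assumes "a \<le> b" "continuous_on {a..b} g"
  shows "(integral {a..b} g)\<^sup>2 \<le> (b - a) * integral {a..b} (\<lambda>x. (g x)\<^sup>2)"
proof (cases "a = b")
  case False
  define I where "I = integral {a..b} g"
  define l where "l = b - a"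
  have l: "l > 0" using False assms by (simp add: l_def)
  have i1: "g integrable_on {a..b}" and i2: "(\<lambda>x. (g x)\<^sup>2) integrable_on {a..b}"
    using assms by (auto intro!: integrable_continuous_real continuous_intros)
  have "0 \<le> integral {a..b} (\<lambda>x. (l * g x - I)\<^sup>2)"
    using assms by (intro integral_nonneg integrable_continuous_real continuous_intros) auto
  also have "(\<lambda>x. (l * g x - I)\<^sup>2) = (\<lambda>x. (l\<^sup>2 * (g x)\<^sup>2 - (2 * l * I) * g x) + I\<^sup>2)"
    by (auto simp: power2_eq_square algebra_simps)
  also have "integral {a..b} \<dots> = l\<^sup>2 * integral {a..b} (\<lambda>x. (g x)\<^sup>2) - 2 * l * I * I + I\<^sup>2 * l"
    using i1 i2 l
    by (subst Henstock_Kurzweil_Integration.integral_add integrable_const_ivl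
          Henstock_Kurzweil_Integration.integral_diff;
        (intro integrable_diff integrable_on_mult_right integrable_const_ivl)?;
        simp add: l_def flip: I_def)+
  also have "\<dots> = l * (l * integral {a..b} (\<lambda>x. (g x)\<^sup>2) - I\<^sup>2)"
    by (simp add: power2_eq_square algebra_simps)
  finally show ?thesis using l by (simp add: zero_le_mult_iff I_def l_def)
qed auto

lemma integral_eq_of_zero_outside:
  fixes g :: "'a::euclidean_space \<Rightarrow> 'b::banach"
  assumes "\<And>x. x \<in> S \<Longrightarrow> x \<notin> T \<Longrightarrow> g x = 0" "\<And>x. x \<in> T \<Longrightarrow> x \<notin> S \<Longrightarrow> g x = 0"
  shows "integral S g = integral T g"
  unfolding integral_restrict_UNIV[of S g, symmetric] integral_restrict_UNIV[of T g, symmetric]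
  by (rule arg_cong[where f = "integral UNIV"]) (use assms in auto)

lemma integral_derivative_fst:
  fixes h h' :: "real \<times> 'b::euclidean_space \<Rightarrow> real"
  assumes "a \<le> b" "continuous_on (cbox (a, c) (b, d)) h'"
    and "\<And>x w. x \<in> {a..b} \<Longrightarrow> w \<in> cbox c d \<Longrightarrow> ((\<lambda>y. h (y, w)) has_real_derivative h' (x, w)) (at x)"
  shows "integral (cbox (a, c) (b, d)) h' = integral (cbox c d) (\<lambda>w. h (b, w) - h (a, w))"
proof -
  have "integral (cbox (a, c) (b, d)) h' = integral (cbox a b) (\<lambda>x. integral (cbox c d) (\<lambda>w. h' (x, w)))"
    using assms by (intro integral_prod_continuous)
  also have "\<dots> = integral (cbox c d) (\<lambda>w. integral (cbox a b) (\<lambda>x. h' (x, w)))"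
    using assms(2) by (intro integral_swap_continuous) simp
  also have "\<dots> = integral (cbox c d) (\<lambda>w. h (b, w) - h (a, w))"
  proof (rule integral_cong, rule integral_unique)
    fix w assume "w \<in> cbox c d"
    then show "((\<lambda>x. h' (x, w)) has_integral h (b, w) - h (a, w)) (cbox a b)"
      using assms(1,3) unfolding cbox_interval
      by (intro fundamental_theorem_of_calculus)
         (auto simp: has_real_derivative_iff_has_vector_derivative intro: has_vector_derivative_at_within)
  qed
  finally show ?thesis .
qed

lemma integral_derivative_snd:
  fixes h h' :: "'b::euclidean_space \<times> real \<Rightarrow> real"
  assumes "a \<le> b" "continuous_on (cbox (c, a) (d, b)) h'"
    and "\<And>x w. x \<in> {a..b} \<Longrightarrow> w \<in> cbox c d \<Longrightarrow> ((\<lambda>y. h (w, y)) has_real_derivative h' (w, x)) (at x)"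
  shows "integral (cbox (c, a) (d, b)) h' = integral (cbox c d) (\<lambda>w. h (w, b) - h (w, a))"
proof -
  have "integral (cbox (c, a) (d, b)) h' = integral (cbox c d) (\<lambda>w. integral (cbox a b) (\<lambda>x. h' (w, x)))"
    using assms by (intro integral_prod_continuous)
  also have "\<dots> = integral (cbox c d) (\<lambda>w. h (w, b) - h (w, a))"
  proof (rule integral_cong, rule integral_unique)
    fix w assume "w \<in> cbox c d"
    then show "((\<lambda>x. h' (w, x)) has_integral h (w, b) - h (w, a)) (cbox a b)"
      using assms(1,3) unfolding cbox_interval
      by (intro fundamental_theorem_of_calculus)
         (auto simp: has_real_derivative_iff_has_vector_derivative intro: has_vector_derivative_at_within)
  qed
  finally show ?thesis .
qed

text \<open>
  The divergence theorem on a square, for a vector field that vanishes on the boundary.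
\<close>
lemma integral_divergence_zero:
  fixes h1 h2 h1' h2' :: "real \<times> real \<Rightarrow> real"
  assumes L: "0 \<le> L"
    and cont: "continuous_on (cbox (-L, -L) (L, L)) h1'" "continuous_on (cbox (-L, -L) (L, L)) h2'"
    and d1: "\<And>v1 v2. ((\<lambda>w. h1 (w, v2)) has_real_derivative h1' (v1, v2)) (at v1)"
    and d2: "\<And>v1 v2. ((\<lambda>w. h2 (v1, w)) has_real_derivative h2' (v1, v2)) (at v2)"
    and zero: "\<And>v. L \<le> norm v \<Longrightarrow> h1 v = 0" "\<And>v. L \<le> norm v \<Longrightarrow> h2 v = 0"
  shows "integral (cbox (-L, -L) (L, L)) (\<lambda>v. h1' v + h2' v) = 0"
proof -
  have *: "L \<le> norm (L, w)" "L \<le> norm (-L, w)" "L \<le> norm (w, L)" "L \<le> norm (w, -L)" for w :: real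
    using norm_fst_le[of L w] norm_fst_le[of "-L" w] norm_snd_le[of L w] norm_snd_le[of "-L" w] L by auto
  have "integral (cbox (-L, -L) (L, L)) h1' = integral (cbox (-L) L) (\<lambda>w. h1 (L, w) - h1 (-L, w))"
    using L cont d1 by (intro integral_derivative_fst) auto
  moreover have "integral (cbox (-L, -L) (L, L)) h2' = integral (cbox (-L) L) (\<lambda>w. h2 (w, L) - h2 (w, -L))"
    using L cont d2 by (intro integral_derivative_snd) auto
  ultimately show ?thesis
    using cont by (simp add: Henstock_Kurzweil_Integration.integral_add integrable_continuous zero *)
qed

lemma lborel_integral_eq_integral_cbox:
  fixes g :: "'a::euclidean_space \<Rightarrow> 'b::euclidean_space"
  assumes "continuous_on (cbox a b) g" "\<And>v. v \<notin> cbox a b \<Longrightarrow> g v = 0"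
  shows "integrable lborel g" "(\<integral>v. g v \<partial>lborel) = integral (cbox a b) g"
proof -
  have eq: "indicator (cbox a b) v *\<^sub>R g v = g v" for v
    using assms(2) by (auto simp: indicator_def)
  have "integrable lborel (\<lambda>v. indicator (cbox a b) v *\<^sub>R g v)"
    using assms(1) by (intro borel_integrable_compact) auto
  then have *: "set_integrable lborel (cbox a b) g" by (simp add: set_integrable_def)
  then show "integrable lborel g" by (simp add: set_integrable_def eq)
  show "(\<integral>v. g v \<partial>lborel) = integral (cbox a b) g"
    using set_borel_integral_eq_integral(2)[OF *] by (simp add: set_lebesgue_integral_def eq)
qed

lemma LBINT_eq_integral_Icc:
  fixes g :: "real \<Rightarrow> real"
  assumes "continuous_on {a..b} g" "\<And>y. y \<in> S \<Longrightarrow> y \<notin> {a..b} \<Longrightarrow> g y = 0" "{a..b} \<subseteq> S"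
  shows "(LBINT y:S. g y) = integral {a..b} g"
proof -
  have "(LBINT y:S. g y) = (LBINT y:{a..b}. g y)"
    unfolding set_lebesgue_integral_def
    by (rule Bochner_Integration.integral_cong) (use assms(2,3) in \<open>auto simp: indicator_def\<close>)
  also have "\<dots> = integral {a..b} g"
    by (intro set_borel_integral_eq_integral borel_integrable_atLeastAtMost' assms(1))
  finally show ?thesis .
qed

lemma le_norm_outside_cbox:
  assumes "v \<notin> cbox (-L, -L) (L, L)"
  shows "L \<le> norm (v :: real \<times> real)" "L < norm v"
proof -
  obtain v1 v2 where v: "v = (v1, v2)" by (cases v)
  then have "L < \<bar>v1\<bar> \<or> L < \<bar>v2\<bar>" using assms by auto
  then show "L < norm v" using norm_fst_le[of v1 v2] norm_snd_le[of v2 v1] by (auto simp: v)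
  then show "L \<le> norm v" by simp
qed

section \<open>Relativistic velocity and energy\<close>

lemma norm_vhat_le_1: "norm (vhat m v) \<le> 1"
proof -
  define s where "s = sqrt (m\<^sup>2 + (norm v)\<^sup>2)"
  have "norm v \<le> s" unfolding s_def by (rule real_le_rsqrt) auto
  moreover have "norm (vhat m v) = norm v / \<bar>s\<bar>"
    by (simp add: vhat_def s_def divide_inverse mult.commute)
  moreover have "0 \<le> s" by (simp add: s_def)
  ultimately show ?thesis by (auto simp: divide_le_eq_1)
qed

lemma vhat_components_le_1: "\<bar>fst (vhat m v)\<bar> \<le> 1" "\<bar>snd (vhat m v)\<bar> \<le> 1"
  using norm_vhat_le_1[of m v] norm_fst_le[of "fst (vhat m v)" "snd (vhat m v)"]
    norm_snd_le[of "snd (vhat m v)" "fst (vhat m v)"] by auto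

lemma fst_vhat: "fst (vhat m (v1, v2)) = v1 / sqrt (m\<^sup>2 + v1\<^sup>2 + v2\<^sup>2)"
  and snd_vhat: "snd (vhat m (v1, v2)) = v2 / sqrt (m\<^sup>2 + v1\<^sup>2 + v2\<^sup>2)"
  by (simp_all add: vhat_def norm_Pair add.assoc divide_inverse mult.commute)

lemma energy_radicand_pos:
  assumes "m > (0::real)"
  shows "m\<^sup>2 + v1\<^sup>2 + v2\<^sup>2 > 0"
  using assms by (simp add: add_pos_nonneg)

definition particle_energy :: "real \<Rightarrow> real \<times> real \<Rightarrow> real" where
  "particle_energy m v = sqrt (m\<^sup>2 + (norm v)\<^sup>2)"

lemma particle_energy_nonneg: "0 \<le> particle_energy m v"
  by (simp add: particle_energy_def)

lemma sqrt_quadratic_derivative: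
  fixes c v :: real
  assumes "c + v\<^sup>2 > 0"
  shows "((\<lambda>w. sqrt (c + w\<^sup>2)) has_real_derivative v / sqrt (c + v\<^sup>2)) (at v)"
proof -
  have "((\<lambda>w. c + w\<^sup>2) has_real_derivative 2 * v) (at v)"
    by (auto intro!: derivative_eq_intros)
  from DERIV_chain2[OF DERIV_real_sqrt[OF assms] this] show ?thesis
    by (simp add: inverse_eq_divide)
qed

text \<open>
  The velocity is the momentum gradient of the energy; this turns the kinetic energy balance into the work done by the
  electric field.
\<close>
lemma particle_energy_derivative:
  assumes "m > 0"
  shows "((\<lambda>w. particle_energy m (w, v2)) has_real_derivative fst (vhat m (v1, v2))) (at v1)"
    and "((\<lambda>w. particle_energy m (v1, w)) has_real_derivative snd (vhat m (v1, v2))) (at v2)"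
proof -
  have eq: "particle_energy m (w1, w2) = sqrt (m\<^sup>2 + w1\<^sup>2 + w2\<^sup>2)" for w1 w2
    by (simp add: particle_energy_def norm_Pair add.assoc)
  note pos = energy_radicand_pos[OF assms, of v1 v2]
  show "((\<lambda>w. particle_energy m (w, v2)) has_real_derivative fst (vhat m (v1, v2))) (at v1)"
    unfolding eq fst_vhat
    using sqrt_quadratic_derivative[of "m\<^sup>2 + v2\<^sup>2" v1] pos by (simp add: ac_simps)
  show "((\<lambda>w. particle_energy m (v1, w)) has_real_derivative snd (vhat m (v1, v2))) (at v2)"
    unfolding eq snd_vhat
    using sqrt_quadratic_derivative[of "m\<^sup>2 + v1\<^sup>2" v2] pos by simp
qed

text \<open>
  The two mixed derivatives agree, so that the magnetic force \<open>B (v\<^sub>2, - v\<^sub>1) / sqrt (m\<^sup>2 + \<bar>v\<bar>\<^sup>2)\<close> has no divergence in \<open>v\<close>.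
\<close>
lemma vhat_cross_derivative:
  assumes "m > 0"
  shows "((\<lambda>w. snd (vhat m (w, v2))) has_real_derivative
      - v1 * v2 / (m\<^sup>2 + v1\<^sup>2 + v2\<^sup>2) / sqrt (m\<^sup>2 + v1\<^sup>2 + v2\<^sup>2)) (at v1)"
    and "((\<lambda>w. fst (vhat m (v1, w))) has_real_derivative
      - v1 * v2 / (m\<^sup>2 + v1\<^sup>2 + v2\<^sup>2) / sqrt (m\<^sup>2 + v1\<^sup>2 + v2\<^sup>2)) (at v2)"
proof -
  note pos = energy_radicand_pos[OF assms, of v1 v2]
  then have nz: "sqrt (m\<^sup>2 + v1\<^sup>2 + v2\<^sup>2) \<noteq> 0" by simp
  have sq: "sqrt (m\<^sup>2 + v1\<^sup>2 + v2\<^sup>2) * sqrt (m\<^sup>2 + v1\<^sup>2 + v2\<^sup>2) = m\<^sup>2 + v1\<^sup>2 + v2\<^sup>2"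
    using pos by simp
  have "((\<lambda>w. sqrt (m\<^sup>2 + w\<^sup>2 + v2\<^sup>2)) has_real_derivative v1 / sqrt (m\<^sup>2 + v1\<^sup>2 + v2\<^sup>2)) (at v1)"
    using sqrt_quadratic_derivative[of "m\<^sup>2 + v2\<^sup>2" v1] pos by (simp add: ac_simps)
  from DERIV_divide[OF DERIV_const[of v2] this nz]
  show "((\<lambda>w. snd (vhat m (w, v2))) has_real_derivative
      - v1 * v2 / (m\<^sup>2 + v1\<^sup>2 + v2\<^sup>2) / sqrt (m\<^sup>2 + v1\<^sup>2 + v2\<^sup>2)) (at v1)"
    unfolding snd_vhat sq by (simp add: mult.commute)
  have "((\<lambda>w. sqrt (m\<^sup>2 + v1\<^sup>2 + w\<^sup>2)) has_real_derivative v2 / sqrt (m\<^sup>2 + v1\<^sup>2 + v2\<^sup>2)) (at v2)"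
    using sqrt_quadratic_derivative[of "m\<^sup>2 + v1\<^sup>2" v2] pos by simp
  from DERIV_divide[OF DERIV_const[of v1] this nz]
  show "((\<lambda>w. fst (vhat m (v1, w))) has_real_derivative
      - v1 * v2 / (m\<^sup>2 + v1\<^sup>2 + v2\<^sup>2) / sqrt (m\<^sup>2 + v1\<^sup>2 + v2\<^sup>2)) (at v2)"
    unfolding fst_vhat sq by (simp add: mult.commute)
qed

lemma continuous_on_vhat:
  assumes "m > 0" "continuous_on S g"
  shows "continuous_on S (\<lambda>s. vhat m (g s))"
proof -
  have "m\<^sup>2 + (norm (g s))\<^sup>2 \<noteq> 0" for s
    using assms(1) by (metis add_pos_nonneg less_numeral_extra(3) zero_le_power2 zero_less_power)
  then show ?thesis
    unfolding vhat_def using assms by (intro continuous_intros) auto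
qed

lemma continuous_on_particle_energy:
  "continuous_on S g \<Longrightarrow> continuous_on S (\<lambda>s. particle_energy m (g s))"
  unfolding particle_energy_def by (intro continuous_intros)

section \<open>Constants determined by the data\<close>

definition data_mass :: "(nat \<Rightarrow> real \<Rightarrow> real \<times> real \<Rightarrow> real) \<Rightarrow> real \<Rightarrow> real \<Rightarrow> nat \<Rightarrow> real" where
  "data_mass f0 C0 L \<alpha> = integral (cbox (-C0, -L, -L) (C0, L, L)) (\<lambda>z. f0 \<alpha> (fst z) (snd z))"

text \<open>
  The initial energy without the part carried by \<open>E1\<close>, which is not square integrable unless the data are neutral.
\<close>
definition data_energy ::
  "nat \<Rightarrow> (nat \<Rightarrow> real) \<Rightarrow> (nat \<Rightarrow> real \<Rightarrow> real \<times> real \<Rightarrow> real) \<Rightarrow> (real \<Rightarrow> real) \<Rightarrow> (real \<Rightarrow> real) \<Rightarrow> real \<Rightarrow> real \<Rightarrow> real"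
  where
  "data_energy N m f0 E20 B0 C0 L =
     (\<Sum>\<alpha>=1..N. integral (cbox (-C0, -L, -L) (C0, L, L)) (\<lambda>z. f0 \<alpha> (fst z) (snd z) * particle_energy (m \<alpha>) (snd z)))
     + 1/2 * integral {-C0..C0} (\<lambda>x. (E20 x)\<^sup>2 + (B0 x)\<^sup>2)"

text \<open>
  A bound for the initial \<open>E1\<close>: the charge to the left of a point and the charge to its right each count with weight
  one half.
\<close>
definition data_field_bound ::
  "nat \<Rightarrow> (nat \<Rightarrow> real) \<Rightarrow> (nat \<Rightarrow> real \<Rightarrow> real \<times> real \<Rightarrow> real) \<Rightarrow> real \<Rightarrow> real \<Rightarrow> real" where
  "data_field_bound N e f0 C0 L = (\<Sum>\<alpha>=1..N. \<bar>e \<alpha>\<bar> / 2 * data_mass f0 C0 L \<alpha>)"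

lemma initial_velocity_support_bounded:
  assumes "admissible_data N f0 E20 B0 C0"
  obtains L where "0 < L" "\<And>\<alpha> x v. \<alpha> \<in> {1..N} \<Longrightarrow> f0 \<alpha> x v \<noteq> 0 \<Longrightarrow> norm v \<le> L"
proof -
  have "\<exists>l. \<forall>x v. f0 \<alpha> x v \<noteq> 0 \<longrightarrow> norm v \<le> l" if "\<alpha> \<in> {1..N}" for \<alpha>
  proof -
    have "C1_compact_support (\<lambda>(x, v). f0 \<alpha> x v)"
      using assms that unfolding admissible_data_def by blast
    then have "bounded {z. (\<lambda>(x, v). f0 \<alpha> x v) z \<noteq> 0}"
      unfolding C1_compact_support_def using bounded_subset[OF compact_imp_bounded closure_subset] by blast
    then obtain l where l: "\<forall>z\<in>{z. (\<lambda>(x, v). f0 \<alpha> x v) z \<noteq> 0}. norm z \<le> l"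
      unfolding bounded_iff by blast
    have "norm v \<le> l" if "f0 \<alpha> x v \<noteq> 0" for x v
      using bspec[OF l, of "(x, v)"] norm_snd_le[of v x] that by simp
    then show ?thesis by blast
  qed
  then obtain l where l: "\<And>\<alpha> x v. \<alpha> \<in> {1..N} \<Longrightarrow> f0 \<alpha> x v \<noteq> 0 \<Longrightarrow> norm v \<le> l \<alpha>" by metis
  show thesis
  proof (rule that[of "(\<Sum>\<alpha>=1..N. \<bar>l \<alpha>\<bar>) + 1"])
    show "0 < (\<Sum>\<alpha>=1..N. \<bar>l \<alpha>\<bar>) + 1" by (intro add_nonneg_pos sum_nonneg) auto
    show "norm v \<le> (\<Sum>\<alpha>=1..N. \<bar>l \<alpha>\<bar>) + 1" if "\<alpha> \<in> {1..N}" "f0 \<alpha> x v \<noteq> 0" for \<alpha> x v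
      using l[OF that] member_le_sum[of \<alpha> "{1..N}" "\<lambda>\<alpha>. \<bar>l \<alpha>\<bar>"] that(1) by fastforce
  qed
qed

section \<open>Transport of the densities\<close>

locale RVM =
  fixes N :: nat and m e :: "nat \<Rightarrow> real"
    and f0 :: "nat \<Rightarrow> real \<Rightarrow> real \<times> real \<Rightarrow> real"
    and E20 B0 :: "real \<Rightarrow> real" and C0 :: real
    and f :: "nat \<Rightarrow> real \<Rightarrow> real \<Rightarrow> real \<times> real \<Rightarrow> real"
    and E1 E2 B :: "real \<Rightarrow> real \<Rightarrow> real"
  assumes mass: "\<And>\<alpha>. \<alpha> \<in> {1..N} \<Longrightarrow> m \<alpha> > 0"
    and data: "admissible_data N f0 E20 B0 C0"
    and solution: "RVM_solution N m e f0 E20 B0 f E1 E2 B"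

begin

definition F :: "nat \<Rightarrow> real \<times> real \<times> real \<times> real \<Rightarrow> real" where
  "F \<alpha> = (\<lambda>(t, x, v). f \<alpha> t x v)"

definition force :: "nat \<Rightarrow> real \<Rightarrow> real \<Rightarrow> real \<times> real \<Rightarrow> real \<times> real" where
  "force \<alpha> t x v = (e \<alpha> * (E1 t x + snd (vhat (m \<alpha>) v) * B t x),
                    e \<alpha> * (E2 t x - fst (vhat (m \<alpha>) v) * B t x))"

lemma F_apply [simp]: "F \<alpha> (t, x, v) = f \<alpha> t x v"
  by (simp add: F_def)

lemma C0_pos: "C0 > 0"
  using data by (simp add: admissible_data_def)

lemma C1_F: "\<alpha> \<in> {1..N} \<Longrightarrow> C1_on ({0..} \<times> UNIV) (F \<alpha>)"
  and C1_E1: "C1_on ({0..} \<times> UNIV) (\<lambda>(t, x). E1 t x)"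
  and C1_E2: "C1_on ({0..} \<times> UNIV) (\<lambda>(t, x). E2 t x)"
  and C1_B: "C1_on ({0..} \<times> UNIV) (\<lambda>(t, x). B t x)"
  using solution by (auto simp: RVM_solution_def F_def)

lemma initial_values:
  shows "\<alpha> \<in> {1..N} \<Longrightarrow> f \<alpha> 0 x v = f0 \<alpha> x v" "E2 0 x = E20 x" "B 0 x = B0 x"
  using solution unfolding RVM_solution_def by blast+

lemma data_zero:
  assumes "C0 \<le> \<bar>x\<bar>"
  shows "\<alpha> \<in> {1..N} \<Longrightarrow> f0 \<alpha> x v = 0" "E20 x = 0" "B0 x = 0"
  using data assms unfolding admissible_data_def by blast+

lemma f0_nonneg: "\<alpha> \<in> {1..N} \<Longrightarrow> 0 \<le> f0 \<alpha> x v"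
  using data unfolding admissible_data_def by blast

lemma f_partials:
  assumes "\<alpha> \<in> {1..N}" "0 \<le> t"
  shows "((\<lambda>s. f \<alpha> s x v) has_real_derivative half_deriv (F \<alpha>) (t, x, v) (1, 0, 0)) (at t within {0..})"
    and "((\<lambda>y. f \<alpha> t y v) has_real_derivative half_deriv (F \<alpha>) (t, x, v) (0, 1, 0)) (at x)"
    and "((\<lambda>w. f \<alpha> t x (w, v2)) has_real_derivative half_deriv (F \<alpha>) (t, x, v1, v2) (0, 0, 1, 0)) (at v1)"
    and "((\<lambda>w. f \<alpha> t x (v1, w)) has_real_derivative half_deriv (F \<alpha>) (t, x, v1, v2) (0, 0, 0, 1)) (at v2)"
  using half_deriv_time[OF C1_F[OF assms(1)] assms(2), of "(x, v)"]
    half_deriv_line[OF C1_F[OF assms(1)] assms(2), of "(0, v)" "(1, 0, 0)" x]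
    half_deriv_line[OF C1_F[OF assms(1)] assms(2), of "(x, 0, v2)" "(0, 1, 0)" v1]
    half_deriv_line[OF C1_F[OF assms(1)] assms(2), of "(x, v1, 0)" "(0, 0, 1)" v2]
  by (cases v; simp add: has_real_derivative_iff_has_vector_derivative zero_prod_def)+

lemma field_partials:
  assumes "C1_on ({0..} \<times> UNIV) (\<lambda>(t, x). G t x)" "0 \<le> t"
  shows "((\<lambda>s. G s x) has_real_derivative half_deriv (\<lambda>(t, x). G t x) (t, x) (1, 0)) (at t within {0..})"
    and "((\<lambda>y. G t y) has_real_derivative half_deriv (\<lambda>(t, x). G t x) (t, x) (0, 1)) (at x)"
  using half_deriv_time[OF assms, of x] half_deriv_line[OF assms, of 0 1 x]
  by (simp_all add: has_real_derivative_iff_has_vector_derivative)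

text \<open>
  By linearity the four partial derivatives in the Vlasov equation combine into one derivative in the characteristic
  direction.
\<close>
lemma vlasov:
  assumes "\<alpha> \<in> {1..N}" "0 \<le> t"
  shows "half_deriv (F \<alpha>) (t, x, v) (1, fst (vhat (m \<alpha>) v), force \<alpha> t x v) = 0"
proof -
  obtain v1 v2 where v: "v = (v1, v2)" by (cases v)
  let ?D = "half_deriv (F \<alpha>) (t, x, v)"
  let ?a = "fst (vhat (m \<alpha>) v)" and ?b = "fst (force \<alpha> t x v)" and ?c = "snd (force \<alpha> t x v)"
  note p = f_partials[OF assms]
  have eq: "vector_derivative (\<lambda>s. f \<alpha> s x (v1, v2)) (at t within {0..})
        + fst (vhat (m \<alpha>) (v1, v2)) * deriv (\<lambda>y. f \<alpha> t y (v1, v2)) x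
        + e \<alpha> * (E1 t x + snd (vhat (m \<alpha>) (v1, v2)) * B t x) * deriv (\<lambda>w. f \<alpha> t x (w, v2)) v1
        + e \<alpha> * (E2 t x - fst (vhat (m \<alpha>) (v1, v2)) * B t x) * deriv (\<lambda>w. f \<alpha> t x (v1, w)) v2
        = 0"
    using solution assms unfolding RVM_solution_def by blast
  have "(1, ?a, force \<alpha> t x v) =
      (1, 0, 0) + ?a *\<^sub>R (0, 1, 0) + ?b *\<^sub>R (0, 0, 1, 0) + ?c *\<^sub>R (0, 0, 0, 1)"
    by (simp add: force_def zero_prod_def)
  then have "?D (1, ?a, force \<alpha> t x v) =
      ?D ((1, 0, 0) + ?a *\<^sub>R (0, 1, 0) + ?b *\<^sub>R (0, 0, 1, 0) + ?c *\<^sub>R (0, 0, 0, 1))" by (rule arg_cong)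
  also have "\<dots> = ?D (1, 0, 0) + ?a * ?D (0, 1, 0) + ?b * ?D (0, 0, 1, 0) + ?c * ?D (0, 0, 0, 1)"
    by (simp only: blinfun.add_right blinfun.scaleR_right real_scaleR_def)
  also have "\<dots> = 0"
    using eq vector_derivative_half_line[OF p(1)[unfolded has_real_derivative_iff_has_vector_derivative] assms(2)]
      DERIV_imp_deriv[OF p(2)] DERIV_imp_deriv[OF p(3)] DERIV_imp_deriv[OF p(4)]
    by (simp add: v force_def)
  finally show ?thesis .
qed

lemma maxwell:
  assumes "0 \<le> t"
  shows "half_deriv (\<lambda>(t, x). E2 t x) (t, x) (1, 0) =
      - snd (current_density N m e f t x) - half_deriv (\<lambda>(t, x). B t x) (t, x) (0, 1)"
    and "half_deriv (\<lambda>(t, x). B t x) (t, x) (1, 0) = - half_deriv (\<lambda>(t, x). E2 t x) (t, x) (0, 1)"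
proof -
  note p = field_partials[OF C1_E2 assms] and q = field_partials[OF C1_B assms]
  note d = vector_derivative_half_line[OF p(1)[unfolded has_real_derivative_iff_has_vector_derivative] assms]
     vector_derivative_half_line[OF q(1)[unfolded has_real_derivative_iff_has_vector_derivative] assms]
      DERIV_imp_deriv[OF p(2)] DERIV_imp_deriv[OF q(2)]
  have "vector_derivative (\<lambda>s. E2 s x) (at t within {0..}) + deriv (\<lambda>y. B t y) x
        = - snd (current_density N m e f t x)"
    "vector_derivative (\<lambda>s. B s x) (at t within {0..}) + deriv (\<lambda>y. E2 t y) x = 0"
    using solution assms unfolding RVM_solution_def by blast+
  then show "half_deriv (\<lambda>(t, x). E2 t x) (t, x) (1, 0) =
      - snd (current_density N m e f t x) - half_deriv (\<lambda>(t, x). B t x) (t, x) (0, 1)"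
    and "half_deriv (\<lambda>(t, x). B t x) (t, x) (1, 0) = - half_deriv (\<lambda>(t, x). E2 t x) (t, x) (0, 1)"
    unfolding d by simp_all
qed

lemma continuous_on_field:
  assumes "C1_on ({0..} \<times> UNIV) (\<lambda>(t, x). G t x)"
    and "continuous_on S g" "continuous_on S h" "\<And>s. s \<in> S \<Longrightarrow> 0 \<le> g s"
  shows "continuous_on S (\<lambda>s. G (g s) (h s))"
  using continuous_on_C1[OF assms(1) continuous_on_Pair[OF assms(2,3)]] assms(4) by simp

lemma continuous_on_f:
  assumes "\<alpha> \<in> {1..N}" "continuous_on S g" "continuous_on S h" "continuous_on S k" "\<And>s. s \<in> S \<Longrightarrow> 0 \<le> g s"
  shows "continuous_on S (\<lambda>s. f \<alpha> (g s) (h s) (k s))"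
  using continuous_on_C1[OF C1_F[OF assms(1)] continuous_on_Pair[OF assms(2) continuous_on_Pair[OF assms(3,4)]]]
    assms(5) by simp

lemma continuous_on_fields:
  assumes "0 \<le> t"
  shows "continuous_on S (E1 t)" "continuous_on S (E2 t)" "continuous_on S (B t)"
  using assms by (auto intro!: continuous_on_field[OF C1_E1] continuous_on_field[OF C1_E2]
      continuous_on_field[OF C1_B] continuous_intros)

lemma continuous_on_force:
  assumes "\<alpha> \<in> {1..N}" "0 \<le> t" "continuous_on S g" "continuous_on S h"
  shows "continuous_on S (\<lambda>s. force \<alpha> t (g s) (h s))"
  unfolding force_def using assms
  by (intro continuous_intros continuous_on_field[OF C1_E1] continuous_on_field[OF C1_E2]
      continuous_on_field[OF C1_B] continuous_on_vhat mass) auto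

lemma norm_force_le:
  "norm (force \<alpha> t x v) \<le> \<bar>e \<alpha>\<bar> * (\<bar>E1 t x\<bar> + \<bar>E2 t x\<bar> + 2 * \<bar>B t x\<bar>)"
proof -
  have "\<bar>snd (vhat (m \<alpha>) v) * B t x\<bar> \<le> 1 * \<bar>B t x\<bar>" "\<bar>fst (vhat (m \<alpha>) v) * B t x\<bar> \<le> 1 * \<bar>B t x\<bar>"
    unfolding abs_mult by (intro mult_right_mono vhat_components_le_1 abs_ge_zero)+
  then have "\<bar>E1 t x + snd (vhat (m \<alpha>) v) * B t x\<bar> + \<bar>E2 t x - fst (vhat (m \<alpha>) v) * B t x\<bar>
      \<le> \<bar>E1 t x\<bar> + \<bar>E2 t x\<bar> + 2 * \<bar>B t x\<bar>" by linarith
  then have "\<bar>e \<alpha>\<bar> * (\<bar>E1 t x + snd (vhat (m \<alpha>) v) * B t x\<bar> + \<bar>E2 t x - fst (vhat (m \<alpha>) v) * B t x\<bar>)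
      \<le> \<bar>e \<alpha>\<bar> * (\<bar>E1 t x\<bar> + \<bar>E2 t x\<bar> + 2 * \<bar>B t x\<bar>)"
    by (intro mult_left_mono) auto
  moreover have "norm (force \<alpha> t x v) \<le> \<bar>fst (force \<alpha> t x v)\<bar> + \<bar>snd (force \<alpha> t x v)\<bar>"
    using norm_Pair_le[of "fst (force \<alpha> t x v)" "snd (force \<alpha> t x v)"] by simp
  moreover have "\<bar>fst (force \<alpha> t x v)\<bar> + \<bar>snd (force \<alpha> t x v)\<bar>
      = \<bar>e \<alpha>\<bar> * (\<bar>E1 t x + snd (vhat (m \<alpha>) v) * B t x\<bar> + \<bar>E2 t x - fst (vhat (m \<alpha>) v) * B t x\<bar>)"
    by (simp only: force_def fst_conv snd_conv abs_mult distrib_left[of "\<bar>e \<alpha>\<bar>"])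
  ultimately show ?thesis by linarith
qed

text \<open>
  A bound on bounded parts of space-time that holds for all momenta, because speeds are at most one. It limits the width in
  \<open>v\<close> of the cones of dependence.
\<close>
lemma force_bound_exists:
  obtains K where "0 \<le> K"
    "\<And>\<alpha> t x v. \<alpha> \<in> {1..N} \<Longrightarrow> 0 \<le> t \<Longrightarrow> t \<le> T \<Longrightarrow> \<bar>x\<bar> \<le> R \<Longrightarrow> norm (force \<alpha> t x v) \<le> K"
proof -
  have "continuous_on ({0..T} \<times> {-R..R}) (\<lambda>p. \<bar>E1 (fst p) (snd p)\<bar> + \<bar>E2 (fst p) (snd p)\<bar> + 2 * \<bar>B (fst p) (snd p)\<bar>)"
    by (intro continuous_intros continuous_on_field[OF C1_E1] continuous_on_field[OF C1_E2] continuous_on_field[OF C1_B]) auto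
  then have "bounded ((\<lambda>p. \<bar>E1 (fst p) (snd p)\<bar> + \<bar>E2 (fst p) (snd p)\<bar> + 2 * \<bar>B (fst p) (snd p)\<bar>) ` ({0..T} \<times> {-R..R}))"
    by (intro compact_imp_bounded compact_continuous_image compact_Times) auto
  then obtain M where M: "\<And>t x. 0 \<le> t \<Longrightarrow> t \<le> T \<Longrightarrow> \<bar>x\<bar> \<le> R \<Longrightarrow> \<bar>E1 t x\<bar> + \<bar>E2 t x\<bar> + 2 * \<bar>B t x\<bar> \<le> M"
    unfolding bounded_iff by (fastforce simp: abs_le_iff)
  define K where "K = (\<Sum>\<alpha>=1..N. \<bar>e \<alpha>\<bar>) * \<bar>M\<bar>"
  show thesis
  proof (rule that)
    show "0 \<le> K" by (simp add: K_def sum_nonneg)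
    fix \<alpha> t x v assume a: "\<alpha> \<in> {1..N}" "0 \<le> t" "t \<le> T" "\<bar>x\<bar> \<le> R"
    have "\<bar>e \<alpha>\<bar> \<le> (\<Sum>\<alpha>=1..N. \<bar>e \<alpha>\<bar>)" using a(1) by (intro member_le_sum) auto
    then have "\<bar>e \<alpha>\<bar> * (\<bar>E1 t x\<bar> + \<bar>E2 t x\<bar> + 2 * \<bar>B t x\<bar>) \<le> K"
      unfolding K_def using M[OF a(2-4)] by (intro mult_mono) (auto intro: sum_nonneg)
    then show "norm (force \<alpha> t x v) \<le> K" using norm_force_le order_trans by blast
  qed
qed

text \<open>
  Speeds of at most one and forces of norm at most \<open>K\<close> are what keeps the characteristic direction inside the cone.
\<close>
lemma transport_comparison:
  assumes \<alpha>: "\<alpha> \<in> {1..N}" and T: "0 \<le> T" and "0 \<le> K"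
    and K: "\<And>s y w. 0 \<le> s \<Longrightarrow> s \<le> T \<Longrightarrow> \<bar>x - y\<bar> \<le> T - s \<Longrightarrow> norm (force \<alpha> s y w) \<le> K"
    and G: "\<And>s y w. 0 \<le> s \<Longrightarrow> s \<le> T \<Longrightarrow> \<bar>x - y\<bar> \<le> T - s \<Longrightarrow> \<exists>D. (G has_derivative D) (at (s, y, w) within {0..} \<times> UNIV)
        \<and> D (1, fst (vhat (m \<alpha>) w), force \<alpha> s y w) \<le> 0"
    and init: "\<And>y w. \<bar>x - y\<bar> \<le> T \<Longrightarrow> norm (v - w) \<le> K * T \<Longrightarrow> G (0, y, w) \<le> 0"
  shows "G (T, x, v) \<le> (0::real)"
proof (rule backward_cone_comparison[OF T \<open>0 \<le> K\<close>])
  fix s y and w :: "real \<times> real"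
  assume *: "0 \<le> s" "s \<le> T" "dist x y \<le> T - s"
  then have **: "\<bar>x - y\<bar> \<le> T - s" by (simp add: dist_real_def)
  from G[OF *(1,2) **] obtain D where "(G has_derivative D) (at (s, y, w) within {0..} \<times> UNIV)"
        "D (1, fst (vhat (m \<alpha>) w), force \<alpha> s y w) \<le> 0" by blast
  then show "\<exists>D a b. (G has_derivative D) (at (s, y, w) within {0..} \<times> UNIV)
        \<and> norm a \<le> 1 \<and> norm b \<le> K \<and> D (1, a, b) \<le> 0"
    using K[OF *(1,2) **, of w] vhat_components_le_1(1)[of "m \<alpha>" w]
    by (metis real_norm_def)
next
  fix y w assume "dist x y \<le> T" "dist v w \<le> K * T"
  then show "G (0, y, w) \<le> 0" by (intro init) (auto simp: dist_norm)
qed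

text \<open>
  Both \<open>f\<close> and \<open>- f\<close> satisfy the hypotheses of the comparison principle.
\<close>
lemma f_domain_of_dependence:
  assumes \<alpha>: "\<alpha> \<in> {1..N}" and T: "0 \<le> T" and "0 \<le> K"
    and K: "\<And>s y w. 0 \<le> s \<Longrightarrow> s \<le> T \<Longrightarrow> \<bar>x - y\<bar> \<le> T - s \<Longrightarrow> norm (force \<alpha> s y w) \<le> K"
    and zero: "\<And>y w. \<bar>x - y\<bar> \<le> T \<Longrightarrow> norm (v - w) \<le> K * T \<Longrightarrow> f0 \<alpha> y w = 0"
  shows "f \<alpha> T x v = 0"
proof -
  have "\<sigma> * F \<alpha> (T, x, v) \<le> 0" for \<sigma>
  proof (rule transport_comparison[OF \<alpha> T \<open>0 \<le> K\<close> K])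
    fix s y :: real and w assume "0 \<le> s"
    then show "\<exists>D. ((\<lambda>a. \<sigma> * F \<alpha> a) has_derivative D) (at (s, y, w) within {0..} \<times> UNIV)
        \<and> D (1, fst (vhat (m \<alpha>) w), force \<alpha> s y w) \<le> 0"
      by (intro exI[where x = "\<lambda>h. \<sigma> * half_deriv (F \<alpha>) (s, y, w) h"] conjI
            has_derivative_mult_right half_deriv(1)[OF C1_F[OF \<alpha>]])
         (simp_all add: vlasov[OF \<alpha>])
  qed (use initial_values(1)[OF \<alpha>] zero in auto)
  from this[of 1] this[of "-1"] show ?thesis by simp
qed

lemma f_nonneg:
  assumes \<alpha>: "\<alpha> \<in> {1..N}" and T: "0 \<le> T"
  shows "0 \<le> f \<alpha> T x v"
proof -
  obtain K where K: "0 \<le> K"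
    "\<And>s y w. 0 \<le> s \<Longrightarrow> s \<le> T \<Longrightarrow> \<bar>y\<bar> \<le> \<bar>x\<bar> + T \<Longrightarrow> norm (force \<alpha> s y w) \<le> K"
    using force_bound_exists[of T "\<bar>x\<bar> + T"] \<alpha> by metis
  have "- F \<alpha> (T, x, v) \<le> 0"
  proof (rule transport_comparison[OF \<alpha> T K(1) K(2)])
    fix s y :: real and w assume "0 \<le> s"
    then show "\<exists>D. ((\<lambda>a. - F \<alpha> a) has_derivative D) (at (s, y, w) within {0..} \<times> UNIV)
        \<and> D (1, fst (vhat (m \<alpha>) w), force \<alpha> s y w) \<le> 0"
      by (intro exI[where x = "\<lambda>h. - half_deriv (F \<alpha>) (s, y, w) h"] conjI
            has_derivative_minus half_deriv(1)[OF C1_F[OF \<alpha>]])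
         (simp_all add: vlasov[OF \<alpha>])
  qed (use initial_values(1)[OF \<alpha>] f0_nonneg[OF \<alpha>] in auto)
  then show ?thesis by simp
qed

lemma f_zero_outside_cone:
  assumes \<alpha>: "\<alpha> \<in> {1..N}" and T: "0 \<le> T" and x: "C0 + T \<le> \<bar>x\<bar>"
  shows "f \<alpha> T x v = 0"
proof -
  obtain K where K: "0 \<le> K"
    "\<And>s y w. 0 \<le> s \<Longrightarrow> s \<le> T \<Longrightarrow> \<bar>y\<bar> \<le> \<bar>x\<bar> + T \<Longrightarrow> norm (force \<alpha> s y w) \<le> K"
    using force_bound_exists[of T "\<bar>x\<bar> + T"] \<alpha> by metis
  show ?thesis
    by (rule f_domain_of_dependence[OF \<alpha> T K(1) K(2)]) (use x data_zero(1)[OF _ \<alpha>] in auto)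
qed

text \<open>
  The spatial support at time \<open>t \<le> T\<close> has \<open>\<bar>x\<bar> < C0 + t\<close>, so the backward cones of its points stay in
  \<open>\<bar>x\<bar> \<le> C0 + 2 T\<close>. There the force is bounded by some \<open>K\<close>, and momenta change by at most \<open>K T\<close>.
\<close>
lemma velocity_support_bounded:
  obtains L where "0 < L" "\<And>\<alpha> t x (v :: real \<times> real). \<alpha> \<in> {1..N} \<Longrightarrow> 0 \<le> t \<Longrightarrow> t \<le> T \<Longrightarrow> L \<le> norm v \<Longrightarrow> f \<alpha> t x v = 0"
proof -
  obtain l where l: "0 < l" "\<And>\<alpha> x v. \<alpha> \<in> {1..N} \<Longrightarrow> f0 \<alpha> x v \<noteq> 0 \<Longrightarrow> norm v \<le> l"
    using initial_velocity_support_bounded[OF data] by metis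
  obtain K where K: "0 \<le> K"
    "\<And>\<alpha> t x v. \<alpha> \<in> {1..N} \<Longrightarrow> 0 \<le> t \<Longrightarrow> t \<le> T \<Longrightarrow> \<bar>x\<bar> \<le> C0 + 2 * T \<Longrightarrow> norm (force \<alpha> t x v) \<le> K"
    using force_bound_exists[of T "C0 + 2 * T"] by metis
  show thesis
  proof (rule that[of "l + K * \<bar>T\<bar> + 1"])
    show "0 < l + K * \<bar>T\<bar> + 1" using K l(1) by (intro add_nonneg_pos add_nonneg_nonneg) auto
    fix \<alpha> t x and v :: "real \<times> real"
    assume a: "\<alpha> \<in> {1..N}" "0 \<le> t" "t \<le> T" "l + K * \<bar>T\<bar> + 1 \<le> norm v"
    show "f \<alpha> t x v = 0"
    proof (cases "C0 + t \<le> \<bar>x\<bar>")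
      case False
      show ?thesis
      proof (rule f_domain_of_dependence[OF a(1,2) K(1)])
        show "norm (force \<alpha> s y w) \<le> K" if "0 \<le> s" "s \<le> t" "\<bar>x - y\<bar> \<le> t - s" for s y w
          using that a False by (intro K) auto
        show "f0 \<alpha> y w = 0" if "norm (v - w) \<le> K * t" for y w
        proof (rule ccontr)
          assume "f0 \<alpha> y w \<noteq> 0"
          then have "norm w \<le> l" by (rule l(2)[OF a(1)])
          moreover have "K * t \<le> K * \<bar>T\<bar>" using a K by (intro mult_left_mono) auto
          moreover have "norm v \<le> norm w + norm (v - w)" by norm
          ultimately show False using a(4) that by linarith
        qed
      qed
    qed (rule f_zero_outside_cone[OF a(1,2)])
  qed
qed

section \<open>The fields outside the light cone and the potential\<close>

lemma current_density_zero_outside_cone: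
  assumes "0 \<le> t" "C0 + t \<le> \<bar>x\<bar>"
  shows "current_density N m e f t x = 0"
proof -
  have "(\<Sum>\<alpha>=1..N. (e \<alpha> * f \<alpha> t x v) *\<^sub>R vhat (m \<alpha>) v) = 0" for v
    using f_zero_outside_cone[OF _ assms] by (intro sum.neutral) auto
  then show ?thesis by (simp add: current_density_def)
qed

lemma fields_zero_outside_cone:
  assumes t: "0 \<le> t" and x: "C0 + t \<le> \<bar>x\<bar>"
  shows "E2 t x = 0" "B t x = 0"
proof -
  \<comment> \<open>\<open>E2 + B\<close> and \<open>E2 - B\<close> are transported with speeds \<open>1\<close> and \<open>-1\<close>.\<close>
  have light: "E2 t x + \<sigma> * B t x = 0" if \<sigma>: "\<sigma> = 1 \<or> \<sigma> = - 1" for \<sigma>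
  proof -
    define y where "y = x - t * \<sigma>"
    have out: "C0 + s \<le> \<bar>y + s * \<sigma>\<bar>" if "0 \<le> s" "s \<le> t" for s
      using \<sigma> x that unfolding y_def by auto
    define u where "u s = E2 s (y + s * \<sigma>) + \<sigma> * B s (y + s * \<sigma>)" for s
    have "(u has_vector_derivative 0) (at s within {0..t})" if "s \<in> {0..t}" for s
    proof -
      let ?z = "(s, y + s * \<sigma>)"
      let ?DE = "half_deriv (\<lambda>(t, x). E2 t x) ?z" and ?DB = "half_deriv (\<lambda>(t, x). B t x) ?z"
      have s: "0 \<le> s" "s \<le> t" using that by auto
      have split: "D (1, \<sigma>) = D (1, 0) + \<sigma> * D (0, 1)" for D :: "(real \<times> real) \<Rightarrow>\<^sub>L real"
        using blinfun.add_right[of D "(1, 0)" "\<sigma> *\<^sub>R (0, 1)"] blinfun.scaleR_right[of D \<sigma> "(0, 1)"] by simp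
      have "(u has_vector_derivative ?DE (1, \<sigma>) + \<sigma> * ?DB (1, \<sigma>)) (at s within {0..})"
        using half_deriv_direction[OF C1_E2 s(1), of y \<sigma>] half_deriv_direction[OF C1_B s(1), of y \<sigma>]
        unfolding u_def by (auto intro!: has_vector_derivative_add has_vector_derivative_mult_right)
      also have "?DE (1, \<sigma>) + \<sigma> * ?DB (1, \<sigma>) = 0"
        using \<sigma> unfolding split maxwell[OF s(1)] current_density_zero_outside_cone[OF s(1) out[OF s]] by auto
      finally show ?thesis by (rule has_vector_derivative_within_subset) auto
    qed
    then obtain c where c: "\<And>s. s \<in> {0..t} \<Longrightarrow> u s = c"
      using has_vector_derivative_zero_constant[of "{0..t}" u] by auto
    have "u t = u 0" using c t by simp
    also have "u 0 = 0" using out[of 0] t by (simp add: u_def initial_values data_zero)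
    finally show ?thesis by (simp add: u_def y_def)
  qed
  from light[of 1] light[of "-1"] show "E2 t x = 0" "B t x = 0" by auto
qed

definition potential :: "real \<Rightarrow> real \<Rightarrow> real" where
  "potential t x = integral {..x} (B t)"

lemma potential_eq:
  assumes "0 \<le> t" "C0 + t \<le> R"
  shows "potential t x = integral {-R..x} (B t)"
  unfolding potential_def
  using assms by (intro integral_eq_of_zero_outside) (auto intro!: fields_zero_outside_cone)

lemma potential_time_derivative:
  assumes "0 \<le> t"
  shows "((\<lambda>s. potential s x) has_real_derivative - E2 t x) (at t within {0..})"
proof -
  define R where "R = C0 + t + 1 + \<bar>x\<bar>"
  let ?DE = "half_deriv (\<lambda>(t, x). E2 t x)" and ?DB = "half_deriv (\<lambda>(t, x). B t x)"
  have "((\<lambda>s. integral (cbox (-R) x) (B s)) has_field_derivative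
      integral (cbox (-R) x) (\<lambda>y. ?DB (t, y) (1, 0))) (at t within {0..})"
  proof (rule leibniz_rule_field_derivative)
    show "continuous_on ({0..} \<times> cbox (- R) x) (\<lambda>(s, y). ?DB (s, y) (1, 0))"
      by (rule continuous_on_eq[OF continuous_on_half_deriv[OF C1_B continuous_on_id]]) auto
    show "B s integrable_on cbox (-R) x" if "s \<in> {0..}" for s
      using that by (intro integrable_continuous continuous_on_field[OF C1_B] continuous_intros) auto
  qed (use assms field_partials[OF C1_B] in auto)
  also have "integral (cbox (-R) x) (\<lambda>y. ?DB (t, y) (1, 0)) = integral {-R..x} (\<lambda>y. - ?DE (t, y) (0, 1))"
    using maxwell(2)[OF assms] by simp
  also have "\<dots> = - E2 t x - (- E2 t (-R))"
  proof (intro integral_unique fundamental_theorem_of_calculus)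
    show "-R \<le> x" using C0_pos assms by (simp add: R_def)
    show "((\<lambda>y. - E2 t y) has_vector_derivative - ?DE (t, y) (0, 1)) (at y within {-R..x})" for y
      unfolding has_real_derivative_iff_has_vector_derivative[symmetric]
      by (rule has_field_derivative_at_within[OF DERIV_minus[OF field_partials(2)[OF C1_E2 assms]]])
  qed
  also have "E2 t (-R) = 0"
    using fields_zero_outside_cone(1)[OF assms, of "-R"] C0_pos assms by (simp add: R_def)
  finally have *: "((\<lambda>s. integral {-R..x} (B s)) has_field_derivative - E2 t x) (at t within {0..})"
    by simp
  show ?thesis
  proof (rule has_field_derivative_transform_within[OF * zero_less_one])
    fix s assume "s \<in> {0..}" "dist s t < 1"
    then show "integral {-R..x} (B s) = potential s x"
      by (intro potential_eq[symmetric]) (auto simp: R_def dist_real_def)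
  qed (use assms in auto)
qed

lemma potential_space_derivative:
  assumes "0 \<le> t"
  shows "((\<lambda>y. potential t y) has_real_derivative B t x) (at x)"
proof -
  define R where "R = C0 + t + 1 + \<bar>x\<bar>"
  have x: "x \<in> {-R<..<x+1}" using C0_pos assms by (auto simp: R_def)
  have "((\<lambda>y. integral {-R..y} (B t)) has_real_derivative B t x) (at x within {-R..x+1})"
    using assms x by (intro integral_has_real_derivative continuous_on_field[OF C1_B] continuous_intros) auto
  then have "((\<lambda>y. integral {-R..y} (B t)) has_real_derivative B t x) (at x)"
    using x at_within_Icc_at[of "-R" x "x+1"] by auto
  moreover have "integral {-R..y} (B t) = potential t y" for y
    by (rule potential_eq[symmetric]) (use assms in \<open>auto simp: R_def\<close>)
  ultimately show ?thesis by simp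
qed

lemma potential_has_derivative:
  assumes "0 \<le> t"
  shows "((\<lambda>(t, x). potential t x) has_derivative (\<lambda>(h, k). - E2 t x * h + B t x * k))
    (at (t, x) within {0..} \<times> UNIV)"
proof -
  have "((\<lambda>(t, x). potential t x) has_derivative
      (\<lambda>(h, k). - E2 t x * h + blinfun_apply (blinfun_mult_right (B t x)) k)) (at (t, x) within {0..} \<times> UNIV)"
  proof (rule has_derivative_partialsI)
    show "((\<lambda>t. potential t x) has_derivative (*) (- E2 t x)) (at t within {0..})"
      using potential_time_derivative[OF assms] by (simp add: has_field_derivative_def)
    show "((\<lambda>x. potential t x) has_derivative blinfun_apply (blinfun_mult_right (B t x))) (at x within UNIV)"
      if "t \<in> {0..}" for t x
      using potential_space_derivative[of t x] that by (simp add: has_field_derivative_def)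
    have "continuous_on ({0..} \<times> UNIV) (\<lambda>(t, x). blinfun_mult_right (B t x))"
      unfolding split_beta' by (intro continuous_intros continuous_on_field[OF C1_B]) auto
    then show "continuous (at (t, x) within {0..} \<times> UNIV) (\<lambda>(t, x). blinfun_mult_right (B t x))"
      using assms by (auto simp: continuous_on_eq_continuous_within)
  qed auto
  then show ?thesis by simp
qed

text \<open>
  The total magnetic flux does not change, since \<open>E2\<close> vanishes outside the cone.
\<close>
lemma potential_right_of_cone:
  assumes "0 \<le> t" "C0 + t \<le> x"
  shows "potential t x = potential 0 x"
proof -
  have "((\<lambda>s. potential s x) has_vector_derivative 0) (at s within {0..t})" if "s \<in> {0..t}" for s
  proof -
    have "E2 s x = 0" using that assms C0_pos by (intro fields_zero_outside_cone) auto
    then show ?thesis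
      using potential_time_derivative[of s x] that
      by (auto simp: has_real_derivative_iff_has_vector_derivative intro: has_vector_derivative_within_subset)
  qed
  then obtain c where "\<And>s. s \<in> {0..t} \<Longrightarrow> potential s x = c"
    using has_vector_derivative_zero_constant[of "{0..t}" "\<lambda>s. potential s x"] by auto
  then show ?thesis using assms by simp
qed

lemma initial_potential_bound: "\<bar>potential 0 x\<bar> \<le> integral {-C0..C0} (\<lambda>y. \<bar>B0 y\<bar>)"
proof -
  have B0: "B 0 = B0" by (auto simp: initial_values)
  have cont: "continuous_on S B0" for S
    using continuous_on_field[OF C1_B, of S "\<lambda>_. 0" "\<lambda>x. x"] by (simp add: B0)
  have "potential 0 x = integral {-C0..x} B0" using potential_eq[of 0 C0 x] by (simp add: B0)
  also have "\<dots> = integral {-C0..min x C0} B0"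
    by (intro integral_eq_of_zero_outside) (auto intro: data_zero)
  also have "\<bar>\<dots>\<bar> \<le> integral {-C0..min x C0} (\<lambda>y. \<bar>B0 y\<bar>)"
    using integral_norm_bound_integral[of B0 "{-C0..min x C0}" "\<lambda>y. \<bar>B0 y\<bar>"]
    by (auto intro!: integrable_continuous_real cont continuous_intros)
  also have "\<dots> \<le> integral {-C0..C0} (\<lambda>y. \<bar>B0 y\<bar>)"
    by (intro integral_subset_le integrable_continuous_real cont continuous_intros) auto
  finally show ?thesis .
qed

text \<open>
  From the left edge of the cone if \<open>x \<le> 0\<close>, and otherwise from the right edge, where the value of the potential is
  known from the data. In both cases the interval of integration has length \<open>C0 + t - \<bar>x\<bar>\<close>.
\<close>
lemma potential_bound:
  assumes t: "0 \<le> t" and x: "\<bar>x\<bar> \<le> C0 + t"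
  shows "\<bar>potential t x\<bar> \<le> integral {-C0..C0} (\<lambda>y. \<bar>B0 y\<bar>)
     + sqrt ((C0 + t - \<bar>x\<bar>) * integral {-(C0+t)..C0+t} (\<lambda>y. (B t y)\<^sup>2))"
proof -
  define R where "R = C0 + t"
  note cont = continuous_on_fields(3)[OF t]
  have seg: "\<bar>integral {a..b} (B t)\<bar> \<le> sqrt ((b - a) * integral {-R..R} (\<lambda>y. (B t y)\<^sup>2))"
    if "-R \<le> a" "a \<le> b" "b \<le> R" for a b
  proof (rule real_le_rsqrt)
    have "(integral {a..b} (B t))\<^sup>2 \<le> (b - a) * integral {a..b} (\<lambda>y. (B t y)\<^sup>2)"
      using that cont by (intro integral_square_Cauchy_Schwarz)
    also have "\<dots> \<le> (b - a) * integral {-R..R} (\<lambda>y. (B t y)\<^sup>2)"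
      using that by (intro mult_left_mono integral_subset_le integrable_continuous_real cont continuous_intros) auto
    finally show "\<bar>integral {a..b} (B t)\<bar>\<^sup>2 \<le> (b - a) * integral {-R..R} (\<lambda>y. (B t y)\<^sup>2)" by simp
  qed
  have R: "0 \<le> integral {-C0..C0} (\<lambda>y. \<bar>B0 y\<bar>)"
    using initial_potential_bound[of 0] by linarith
  show ?thesis
  proof (cases "x \<le> 0")
    case True
    then have *: "potential t x = integral {-R..x} (B t)" "R - \<bar>x\<bar> = x - (-R)"
      using potential_eq[OF t, of R x] by (auto simp: R_def)
    have "\<bar>integral {-R..x} (B t)\<bar> \<le> sqrt ((x - (-R)) * integral {-R..R} (\<lambda>y. (B t y)\<^sup>2))"
      using seg[of "-R" x] x True t C0_pos unfolding R_def by auto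
    then show ?thesis using R unfolding R_def[symmetric] * by linarith
  next
    case False
    have "potential t R = potential t x + integral {x..R} (B t)"
      using potential_eq[OF t, of R] x False
      by (simp add: R_def Henstock_Kurzweil_Integration.integral_combine integrable_continuous_real cont)
    moreover have "potential t R = potential 0 R"
      using t by (intro potential_right_of_cone) (auto simp: R_def)
    moreover have "\<bar>integral {x..R} (B t)\<bar> \<le> sqrt ((C0 + t - \<bar>x\<bar>) * integral {-R..R} (\<lambda>y. (B t y)\<^sup>2))"
      using seg[of x R] x False by (auto simp: R_def)
    ultimately show ?thesis using initial_potential_bound[of R] unfolding R_def by linarith
  qed
qed

text \<open>
  Let \<open>p = v\<^sub>2 + e A\<close>, whose derivative in the characteristic direction is zero, and let \<open>b\<close> be a bound for \<open>\<bar>p\<bar>\<close> on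
  the initial support. Then \<open>f (\<plusminus>p - b)\<close> is transported and, because \<open>f\<close> is nonnegative, initially at most zero. It remains
  so, which means \<open>\<bar>p\<bar> \<le> b\<close> wherever \<open>f > 0\<close>.
\<close>
lemma canonical_momentum_bound:
  assumes \<alpha>: "\<alpha> \<in> {1..N}" and t: "0 \<le> T" and f: "f \<alpha> T x v \<noteq> 0"
    and L: "\<And>y w. f0 \<alpha> y w \<noteq> 0 \<Longrightarrow> norm w \<le> L"
  shows "\<bar>snd v + e \<alpha> * potential T x\<bar> \<le> L + \<bar>e \<alpha>\<bar> * integral {-C0..C0} (\<lambda>y. \<bar>B0 y\<bar>)"
proof -
  define b where "b = L + \<bar>e \<alpha>\<bar> * integral {-C0..C0} (\<lambda>y. \<bar>B0 y\<bar>)"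
  define p :: "real \<times> real \<times> real \<times> real \<Rightarrow> real"
    where "p = (\<lambda>(t, x, v). snd v + e \<alpha> * potential t x)"
  define G where "G \<sigma> z = F \<alpha> z * (\<sigma> * p z - b)" for \<sigma> z
  obtain K where K: "0 \<le> K"
    "\<And>s y w. 0 \<le> s \<Longrightarrow> s \<le> T \<Longrightarrow> \<bar>y\<bar> \<le> \<bar>x\<bar> + T \<Longrightarrow> norm (force \<alpha> s y w) \<le> K"
    using force_bound_exists[of T "\<bar>x\<bar> + T"] \<alpha> by metis
  have "G \<sigma> (T, x, v) \<le> 0" if \<sigma>: "\<bar>\<sigma>\<bar> = 1" for \<sigma>
  proof (rule transport_comparison[OF \<alpha> t K(1) K(2)])
    fix s y :: real and w :: "real \<times> real" assume s: "0 \<le> s"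
    let ?D = "half_deriv (F \<alpha>) (s, y, w)"
    let ?dp = "\<lambda>(h, k, l). snd l + e \<alpha> * (- E2 s y * h + B s y * k)"
    have pot: "((\<lambda>z. potential (fst z) (fst (snd z))) has_derivative (\<lambda>(h, k, l). - E2 s y * h + B s y * k))
        (at (s, y, w) within {0..} \<times> UNIV)"
    proof -
      have "((\<lambda>z. (\<lambda>(t, x). potential t x) (fst z, fst (snd z))) has_derivative
          (\<lambda>z. (\<lambda>(h, k). - E2 s y * h + B s y * k) (fst z, fst (snd z)))) (at (s, y, w) within {0..} \<times> UNIV)"
      proof (rule has_derivative_in_compose[where g = "\<lambda>(t, x). potential t x"])
        show "((\<lambda>z. (fst z, fst (snd z))) has_derivative (\<lambda>z. (fst z, fst (snd z))))
            (at (s, y, w) within {0..} \<times> UNIV)"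
          by (auto intro!: derivative_eq_intros)
        show "((\<lambda>(t, x). potential t x) has_derivative (\<lambda>(h, k). - E2 s y * h + B s y * k))
            (at (fst (s, y, w), fst (snd (s, y, w))) within (\<lambda>z. (fst z, fst (snd z))) ` ({0..} \<times> UNIV))"
          using potential_has_derivative[OF s, of y] by (auto intro: has_derivative_subset)
      qed
      then show ?thesis by (simp add: split_beta')
    qed
    have dp: "(p has_derivative ?dp) (at (s, y, w) within {0..} \<times> UNIV)"
      unfolding p_def split_beta' using pot[unfolded split_beta']
      by (auto intro!: derivative_eq_intros)
    have "(G \<sigma> has_derivative (\<lambda>h. F \<alpha> (s, y, w) * (\<sigma> * ?dp h) + ?D h * (\<sigma> * p (s, y, w) - b)))
        (at (s, y, w) within {0..} \<times> UNIV)"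
      unfolding G_def
      using has_derivative_mult[OF half_deriv(1)[OF C1_F[OF \<alpha>] s, of "(y, w)"]
          has_derivative_diff[OF has_derivative_mult_right[OF dp, of \<sigma>] has_derivative_const[of b]]]
      by simp
    moreover have "?dp (1, fst (vhat (m \<alpha>) w), force \<alpha> s y w) = 0"
      by (simp add: force_def algebra_simps)
    ultimately show "\<exists>D. (G \<sigma> has_derivative D) (at (s, y, w) within {0..} \<times> UNIV)
        \<and> D (1, fst (vhat (m \<alpha>) w), force \<alpha> s y w) \<le> 0"
      using vlasov[OF \<alpha> s, of y w] by (auto intro!: exI)
  next
    fix y w
    show "G \<sigma> (0, y, w) \<le> 0"
    proof (cases "f0 \<alpha> y w = 0")
      case False
      have "\<bar>snd w\<bar> \<le> L" using L[OF False] norm_snd_le[of "snd w" "fst w"] by simp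
      moreover have "\<bar>e \<alpha> * potential 0 y\<bar> \<le> \<bar>e \<alpha>\<bar> * integral {-C0..C0} (\<lambda>y. \<bar>B0 y\<bar>)"
        unfolding abs_mult by (intro mult_left_mono initial_potential_bound) auto
      ultimately have "\<bar>p (0, y, w)\<bar> \<le> b" by (auto simp: p_def b_def)
      then have "\<bar>\<sigma> * p (0, y, w)\<bar> \<le> b" using \<sigma> by (simp add: abs_mult)
      then show ?thesis
        using f0_nonneg[OF \<alpha>, of y w] initial_values(1)[OF \<alpha>] by (auto simp: G_def mult_nonneg_nonpos)
    qed (simp add: G_def initial_values(1)[OF \<alpha>])
  qed (use K in auto)
  from this[of 1] this[of "-1"] f_nonneg[OF \<alpha> t, of x v] f
  have "p (T, x, v) \<le> b" "- p (T, x, v) \<le> b"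
    by (auto simp: G_def mult_le_0_iff)
  then show ?thesis by (auto simp: p_def b_def)
qed

section \<open>Moments in the momentum variable\<close>

definition velocity_moment :: "nat \<Rightarrow> real \<Rightarrow> (real \<times> real \<Rightarrow> real) \<Rightarrow> real \<Rightarrow> real \<Rightarrow> real" where
  "velocity_moment \<alpha> L \<psi> t x = integral (cbox (-L, -L) (L, L)) (\<lambda>v. f \<alpha> t x v * \<psi> v)"

definition moment :: "nat \<Rightarrow> real \<Rightarrow> (real \<times> real \<Rightarrow> real) \<Rightarrow> real \<Rightarrow> real \<Rightarrow> real \<Rightarrow> real" where
  "moment \<alpha> L \<psi> a b t = integral (cbox (a, -L, -L) (b, L, L)) (\<lambda>z. f \<alpha> t (fst z) (snd z) * \<psi> (snd z))"

lemma continuous_on_velocity_moment: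
  assumes "\<alpha> \<in> {1..N}" "0 \<le> t" "continuous_on UNIV \<psi>"
  shows "continuous_on S (velocity_moment \<alpha> L \<psi> t)"
  unfolding velocity_moment_def
  by (rule integral_continuous_on_param)
     (use assms in \<open>auto simp: split_beta' intro!: continuous_intros continuous_on_f
        continuous_on_compose2[of UNIV \<psi>]\<close>)

lemma moment_eq_integral:
  assumes "\<alpha> \<in> {1..N}" "0 \<le> t" "continuous_on UNIV \<psi>"
  shows "moment \<alpha> L \<psi> a b t = integral {a..b} (velocity_moment \<alpha> L \<psi> t)"
  unfolding velocity_moment_def moment_def
  by (subst integral_prod_continuous)
     (use assms in \<open>auto intro!: continuous_intros continuous_on_f continuous_on_compose2[of UNIV \<psi>]\<close>)

text \<open>
  Differentiate under the integral and insert the Vlasov equation. The transport term integrates in \<open>x\<close> to the flux through the end points. The force term is a divergence in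
  \<open>v\<close>, up to the source \<open>f (force \<bullet> \<psi>')\<close>, because the force is divergence free in \<open>v\<close>.
\<close>
lemma moment_derivative:
  assumes \<alpha>: "\<alpha> \<in> {1..N}" and t: "0 \<le> t" "t \<le> T" and L: "0 \<le> L" and ab: "a \<le> b"
    and supp: "\<And>x v. L \<le> norm v \<Longrightarrow> f \<alpha> t x v = 0"
    and \<psi>1: "\<And>v1 v2. ((\<lambda>w. \<psi> (w, v2)) has_real_derivative fst (\<psi>' (v1, v2))) (at v1)"
    and \<psi>2: "\<And>v1 v2. ((\<lambda>w. \<psi> (v1, w)) has_real_derivative snd (\<psi>' (v1, v2))) (at v2)"
    and \<psi>: "continuous_on UNIV \<psi>" and \<psi>': "continuous_on UNIV \<psi>'"
  shows "(moment \<alpha> L \<psi> a b has_real_derivative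
      integral (cbox (a, -L, -L) (b, L, L)) (\<lambda>z. f \<alpha> t (fst z) (snd z) * (force \<alpha> t (fst z) (snd z) \<bullet> \<psi>' (snd z)))
      - (velocity_moment \<alpha> L (\<lambda>v. fst (vhat (m \<alpha>) v) * \<psi> v) t b
         - velocity_moment \<alpha> L (\<lambda>v. fst (vhat (m \<alpha>) v) * \<psi> v) t a)) (at t within {0..T})"
proof -
  let ?box = "cbox (a, -L, -L) (b, L, L)" and ?Q = "cbox (-L, -L) (L, L)"
  note m = mass[OF \<alpha>]
  define D where "D = half_deriv (F \<alpha>)"
  have cD: "continuous_on S (\<lambda>s. D (t, g s))"
    if "continuous_on S g" for g and S :: "'c::topological_space set"
    unfolding D_def using that t
    by (intro continuous_on_compose2[OF half_deriv(2)[OF C1_F[OF \<alpha>]]] continuous_intros) auto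
  have c\<psi>: "continuous_on S (\<lambda>s. \<psi> (g s))" "continuous_on S (\<lambda>s. \<psi>' (g s))"
    if "continuous_on S g" for g and S :: "'c::topological_space set"
    using that \<psi> \<psi>' by (auto intro: continuous_on_compose2)
  have cforce: "continuous_on S (\<lambda>s. force \<alpha> t (g s) (h s))"
    if "continuous_on S g" "continuous_on S h" for g h and S :: "'c::topological_space set"
    using that by (rule continuous_on_force[OF \<alpha> t(1)])
  have cf: "continuous_on S (\<lambda>s. f \<alpha> t (g s) (h s))"
    if "continuous_on S g" "continuous_on S h" for g h and S :: "'c::topological_space set"
    using that t by (intro continuous_on_f[OF \<alpha>] continuous_intros) auto
  note cs = continuous_intros cD c\<psi> cforce cf continuous_on_vhat[OF m]
  have "((\<lambda>s. integral ?box (\<lambda>z. f \<alpha> s (fst z) (snd z) * \<psi> (snd z))) has_field_derivative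
      integral ?box (\<lambda>z. D (t, z) (1, 0, 0) * \<psi> (snd z))) (at t within {0..T})"
  proof (rule leibniz_rule_field_derivative)
    show "continuous_on ({0..T} \<times> ?box) (\<lambda>(s, z). D (s, z) (1, 0, 0) * \<psi> (snd z))"
      by (rule continuous_on_eq[where f = "\<lambda>p. D p (1, 0, 0) * \<psi> (snd (snd p))"])
         (auto simp: D_def intro!: continuous_intros c\<psi> continuous_on_subset[OF half_deriv(2)[OF C1_F[OF \<alpha>]]])
    show "(\<lambda>z. f \<alpha> s (fst z) (snd z) * \<psi> (snd z)) integrable_on ?box" if "s \<in> {0..T}" for s
      using that by (intro integrable_continuous continuous_intros continuous_on_f[OF \<alpha>] c\<psi>) auto
    show "((\<lambda>s. f \<alpha> s (fst z) (snd z) * \<psi> (snd z)) has_real_derivative D (s, z) (1, 0, 0) * \<psi> (snd z))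
        (at s within {0..T})" if "s \<in> {0..T}" for s z
      using that f_partials(1)[OF \<alpha>, of s "fst z" "snd z"]
      by (auto simp: D_def intro!: DERIV_cmult_right has_field_derivative_subset[of _ _ s "{0..}"])
  qed (use t in auto)
  also have "integral ?box (\<lambda>z. D (t, z) (1, 0, 0) * \<psi> (snd z)) =
      integral ?box (\<lambda>z. f \<alpha> t (fst z) (snd z) * (force \<alpha> t (fst z) (snd z) \<bullet> \<psi>' (snd z)))
      - integral ?box (\<lambda>z. D (t, z) (0, 1, 0) * (fst (vhat (m \<alpha>) (snd z)) * \<psi> (snd z)))
      - integral ?box (\<lambda>z. D (t, z) (0, 0, force \<alpha> t (fst z) (snd z)) * \<psi> (snd z)
           + f \<alpha> t (fst z) (snd z) * (force \<alpha> t (fst z) (snd z) \<bullet> \<psi>' (snd z)))"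
  proof -
    have eq: "D (t, z) (1, 0, 0) * \<psi> (snd z) =
        f \<alpha> t (fst z) (snd z) * (force \<alpha> t (fst z) (snd z) \<bullet> \<psi>' (snd z))
      - D (t, z) (0, 1, 0) * (fst (vhat (m \<alpha>) (snd z)) * \<psi> (snd z))
      - (D (t, z) (0, 0, force \<alpha> t (fst z) (snd z)) * \<psi> (snd z)
           + f \<alpha> t (fst z) (snd z) * (force \<alpha> t (fst z) (snd z) \<bullet> \<psi>' (snd z)))" for z
    proof -
      obtain x v where z: "z = (x, v)" by (cases z)
      have "(1, fst (vhat (m \<alpha>) v), force \<alpha> t x v) =
          (1, 0, 0) + fst (vhat (m \<alpha>) v) *\<^sub>R (0, 1, 0) + (0, 0, force \<alpha> t x v)"
        by (simp add: zero_prod_def)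
      then have "D (t, x, v) (1, fst (vhat (m \<alpha>) v), force \<alpha> t x v) =
          D (t, x, v) ((1, 0, 0) + fst (vhat (m \<alpha>) v) *\<^sub>R (0, 1, 0) + (0, 0, force \<alpha> t x v))"
        by (rule arg_cong)
      also have "\<dots> = D (t, x, v) (1, 0, 0) + fst (vhat (m \<alpha>) v) * D (t, x, v) (0, 1, 0)
          + D (t, x, v) (0, 0, force \<alpha> t x v)"
        by (simp only: blinfun.add_right blinfun.scaleR_right real_scaleR_def)
      finally have eq: "D (t, x, v) (1, 0, 0) =
          - fst (vhat (m \<alpha>) v) * D (t, x, v) (0, 1, 0) - D (t, x, v) (0, 0, force \<alpha> t x v)"
        using vlasov[OF \<alpha> t(1), of x v] by (simp add: D_def)
      show ?thesis unfolding z fst_conv snd_conv eq by (simp add: algebra_simps)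
    qed
    have "(\<lambda>z. f \<alpha> t (fst z) (snd z) * (force \<alpha> t (fst z) (snd z) \<bullet> \<psi>' (snd z))) integrable_on ?box"
      "(\<lambda>z. D (t, z) (0, 1, 0) * (fst (vhat (m \<alpha>) (snd z)) * \<psi> (snd z))) integrable_on ?box"
      "(\<lambda>z. D (t, z) (0, 0, force \<alpha> t (fst z) (snd z)) * \<psi> (snd z)
           + f \<alpha> t (fst z) (snd z) * (force \<alpha> t (fst z) (snd z) \<bullet> \<psi>' (snd z))) integrable_on ?box"
      using t by (auto intro!: integrable_continuous cs)
    then show ?thesis
      unfolding eq by (simp only: Henstock_Kurzweil_Integration.integral_diff integrable_diff)
  qed
  also have "integral ?box (\<lambda>z. D (t, z) (0, 1, 0) * (fst (vhat (m \<alpha>) (snd z)) * \<psi> (snd z)))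
      = velocity_moment \<alpha> L (\<lambda>v. fst (vhat (m \<alpha>) v) * \<psi> v) t b
         - velocity_moment \<alpha> L (\<lambda>v. fst (vhat (m \<alpha>) v) * \<psi> v) t a"
  proof -
    have "integral ?box (\<lambda>z. D (t, z) (0, 1, 0) * (fst (vhat (m \<alpha>) (snd z)) * \<psi> (snd z)))
      = integral ?Q (\<lambda>v. f \<alpha> t b v * (fst (vhat (m \<alpha>) v) * \<psi> v) - f \<alpha> t a v * (fst (vhat (m \<alpha>) v) * \<psi> v))"
      using ab t f_partials(2)[OF \<alpha> t(1)]
      by (subst integral_derivative_fst[where h = "\<lambda>z. f \<alpha> t (fst z) (snd z) * (fst (vhat (m \<alpha>) (snd z)) * \<psi> (snd z))"])
         (auto simp: D_def[symmetric] intro!: cs DERIV_cmult_right)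
    then show ?thesis
      unfolding velocity_moment_def
      by (subst (asm) Henstock_Kurzweil_Integration.integral_diff)
         (auto intro!: integrable_continuous cs)
  qed
  also have "integral ?box (\<lambda>z. D (t, z) (0, 0, force \<alpha> t (fst z) (snd z)) * \<psi> (snd z)
           + f \<alpha> t (fst z) (snd z) * (force \<alpha> t (fst z) (snd z) \<bullet> \<psi>' (snd z))) = 0"
  proof -
    let ?g = "\<lambda>z. D (t, z) (0, 0, force \<alpha> t (fst z) (snd z)) * \<psi> (snd z)
           + f \<alpha> t (fst z) (snd z) * (force \<alpha> t (fst z) (snd z) \<bullet> \<psi>' (snd z))"
    have "integral ?Q (\<lambda>v. ?g (x, v)) = 0" for x
    proof -
      define \<kappa> :: "real \<times> real \<Rightarrow> real" where "\<kappa> v = - fst v * snd v / ((m \<alpha>)\<^sup>2 + (fst v)\<^sup>2 + (snd v)\<^sup>2)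
          / sqrt ((m \<alpha>)\<^sup>2 + (fst v)\<^sup>2 + (snd v)\<^sup>2)" for v
      have c\<kappa>: "continuous_on S \<kappa>" for S
        unfolding \<kappa>_def using energy_radicand_pos[OF m] by (intro continuous_intros) (auto simp: less_le)
      let ?K1 = "\<lambda>v. fst (force \<alpha> t x v)" and ?K2 = "\<lambda>v. snd (force \<alpha> t x v)"
      define h1' where "h1' v = D (t, x, v) (0, 0, 1, 0) * (?K1 v * \<psi> v)
          + f \<alpha> t x v * (e \<alpha> * (\<kappa> v * B t x) * \<psi> v + ?K1 v * fst (\<psi>' v))" for v
      define h2' where "h2' v = D (t, x, v) (0, 0, 0, 1) * (?K2 v * \<psi> v)
          + f \<alpha> t x v * (- e \<alpha> * (\<kappa> v * B t x) * \<psi> v + ?K2 v * snd (\<psi>' v))" for v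
      have "?g (x, v) = h1' v + h2' v" for v
      proof -
        have "(0, 0, force \<alpha> t x v) = ?K1 v *\<^sub>R (0, 0, 1, 0) + ?K2 v *\<^sub>R (0, 0, 0, 1)" by simp
        then have "D (t, x, v) (0, 0, force \<alpha> t x v) =
            D (t, x, v) (?K1 v *\<^sub>R (0, 0, 1, 0) + ?K2 v *\<^sub>R (0, 0, 0, 1))" by (rule arg_cong)
        also have "\<dots> = ?K1 v * D (t, x, v) (0, 0, 1, 0) + ?K2 v * D (t, x, v) (0, 0, 0, 1)"
          by (simp only: blinfun.add_right blinfun.scaleR_right real_scaleR_def)
        finally show ?thesis
          by (simp add: h1'_def h2'_def inner_prod_def algebra_simps)
      qed
      moreover have "integral ?Q (\<lambda>v. h1' v + h2' v) = 0"
      proof (rule integral_divergence_zero[OF L])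
        show "continuous_on ?Q h1'" "continuous_on ?Q h2'"
          unfolding h1'_def h2'_def using t by (auto intro!: cs c\<kappa>)
        show "((\<lambda>w. f \<alpha> t x (w, v2) * (?K1 (w, v2) * \<psi> (w, v2))) has_real_derivative h1' (v1, v2)) (at v1)" for v1 v2
          using vhat_cross_derivative(1)[OF m, of v2 v1] f_partials(3)[OF \<alpha> t(1), of x v2 v1] \<psi>1[of v2 v1]
          by (auto simp: force_def h1'_def \<kappa>_def D_def intro!: derivative_eq_intros)
        show "((\<lambda>w. f \<alpha> t x (v1, w) * (?K2 (v1, w) * \<psi> (v1, w))) has_real_derivative h2' (v1, v2)) (at v2)" for v1 v2
          using vhat_cross_derivative(2)[OF m, of v1 v2] f_partials(4)[OF \<alpha> t(1), of x v1 v2] \<psi>2[of v1 v2]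
          by (auto simp: force_def h2'_def \<kappa>_def D_def intro!: derivative_eq_intros)
      qed (simp_all add: supp)
      ultimately show ?thesis by simp
    qed
    moreover have "integral ?box ?g = integral (cbox a b) (\<lambda>x. integral ?Q (\<lambda>v. ?g (x, v)))"
      using t by (intro integral_prod_continuous) (auto intro!: cs)
    ultimately show ?thesis by simp
  qed
  finally show ?thesis
    by (simp add: moment_def[abs_def])
qed

lemma moment_nonneg:
  assumes "\<alpha> \<in> {1..N}" "0 \<le> t" "\<And>v. 0 \<le> \<psi> v" "continuous_on UNIV \<psi>"
  shows "0 \<le> moment \<alpha> L \<psi> a b t"
  unfolding moment_def
  by (intro integral_nonneg integrable_continuous continuous_intros continuous_on_f assms
      continuous_on_compose2[OF assms(4)] mult_nonneg_nonneg f_nonneg) auto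

definition current1 :: "real \<Rightarrow> real \<Rightarrow> real \<Rightarrow> real" where
  "current1 L t x = (\<Sum>\<alpha>=1..N. e \<alpha> * velocity_moment \<alpha> L (\<lambda>v. fst (vhat (m \<alpha>) v)) t x)"

definition current2 :: "real \<Rightarrow> real \<Rightarrow> real \<Rightarrow> real" where
  "current2 L t x = (\<Sum>\<alpha>=1..N. e \<alpha> * velocity_moment \<alpha> L (\<lambda>v. snd (vhat (m \<alpha>) v)) t x)"

lemma continuous_on_f_slice:
  assumes "\<alpha> \<in> {1..N}" "0 \<le> t"
  shows "continuous_on S (f \<alpha> t x)"
  using continuous_on_f[OF assms(1), of S "\<lambda>_. t" "\<lambda>_. x" "\<lambda>v. v"] assms(2)
  by (simp add: continuous_on_id)

lemma charge_density_eq: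
  assumes "0 \<le> t" and "\<And>\<alpha> v. \<alpha> \<in> {1..N} \<Longrightarrow> L \<le> norm v \<Longrightarrow> f \<alpha> t x v = 0"
  shows "charge_density N e f t x = (\<Sum>\<alpha>=1..N. e \<alpha> * velocity_moment \<alpha> L (\<lambda>_. 1) t x)"
proof -
  have "charge_density N e f t x = integral (cbox (-L, -L) (L, L)) (\<lambda>v. \<Sum>\<alpha>=1..N. e \<alpha> * f \<alpha> t x v)"
    unfolding charge_density_def
  proof (rule lborel_integral_eq_integral_cbox)
    show "continuous_on (cbox (-L, -L) (L, L)) (\<lambda>v. \<Sum>\<alpha>=1..N. e \<alpha> * f \<alpha> t x v)"
      by (intro continuous_intros continuous_on_f_slice assms(1))
    show "(\<Sum>\<alpha>=1..N. e \<alpha> * f \<alpha> t x v) = 0" if "v \<notin> cbox (-L, -L) (L, L)" for v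
      using assms(2) le_norm_outside_cbox(1)[OF that] by (intro sum.neutral) simp
  qed
  also have "\<dots> = (\<Sum>\<alpha>=1..N. e \<alpha> * velocity_moment \<alpha> L (\<lambda>_. 1) t x)"
    by (subst integral_sum) (auto simp: velocity_moment_def
        intro!: integrable_continuous continuous_intros continuous_on_f_slice assms(1))
  finally show ?thesis .
qed

lemma current_density_eq:
  assumes "0 \<le> t" and "\<And>\<alpha> v. \<alpha> \<in> {1..N} \<Longrightarrow> L \<le> norm v \<Longrightarrow> f \<alpha> t x v = 0"
  shows "snd (current_density N m e f t x) = current2 L t x"
proof -
  let ?h = "\<lambda>v. \<Sum>\<alpha>=1..N. (e \<alpha> * f \<alpha> t x v) *\<^sub>R vhat (m \<alpha>) v"
  have cont: "continuous_on (cbox (-L, -L) (L, L)) ?h"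
    by (intro continuous_intros continuous_on_f_slice continuous_on_vhat mass assms(1))
  have zero: "?h v = 0" if "v \<notin> cbox (-L, -L) (L, L)" for v
    using assms(2) le_norm_outside_cbox(1)[OF that] by (intro sum.neutral) simp
  have "snd (current_density N m e f t x) = (\<integral>v. snd (?h v) \<partial>lborel)"
    unfolding current_density_def
    by (rule integral_bounded_linear[OF bounded_linear_snd lborel_integral_eq_integral_cbox(1)[OF cont zero], symmetric])
  also have "\<dots> = integral (cbox (-L, -L) (L, L)) (\<lambda>v. snd (?h v))"
    using zero by (intro lborel_integral_eq_integral_cbox(2) continuous_on_snd cont) simp
  also have "(\<lambda>v. snd (?h v)) = (\<lambda>v. \<Sum>\<alpha>=1..N. e \<alpha> * (f \<alpha> t x v * snd (vhat (m \<alpha>) v)))"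
    by (simp add: snd_sum mult.assoc)
  also have "integral (cbox (-L, -L) (L, L)) \<dots> = current2 L t x"
    unfolding current2_def velocity_moment_def
    by (subst integral_sum) (auto intro!: integrable_continuous continuous_intros continuous_on_f_slice
        continuous_on_vhat mass assms(1))
  finally show ?thesis .
qed

section \<open>Conservation of energy\<close>

lemma E1_eq:
  assumes t: "0 \<le> t" and R: "C0 + t \<le> R" and x: "\<bar>x\<bar> \<le> R"
    and supp: "\<And>\<alpha> x v. \<alpha> \<in> {1..N} \<Longrightarrow> L \<le> norm v \<Longrightarrow> f \<alpha> t x v = 0"
  shows "E1 t x = (\<Sum>\<alpha>=1..N. e \<alpha> / 2 * (moment \<alpha> L (\<lambda>_. 1) (-R) x t - moment \<alpha> L (\<lambda>_. 1) x R t))"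
proof -
  let ?\<rho> = "charge_density N e f t"
  have \<rho>: "?\<rho> = (\<lambda>y. \<Sum>\<alpha>=1..N. e \<alpha> * velocity_moment \<alpha> L (\<lambda>_. 1) t y)"
    by (intro ext charge_density_eq t supp)
  have cont: "continuous_on S ?\<rho>" for S
    unfolding \<rho> by (intro continuous_intros continuous_on_velocity_moment t)
  have zero: "?\<rho> y = 0" if "R \<le> \<bar>y\<bar>" for y
  proof -
    have "(\<Sum>\<alpha>=1..N. e \<alpha> * f \<alpha> t y v) = 0" for v
      using f_zero_outside_cone[OF _ t, of _ y] that R by (intro sum.neutral) auto
    then show ?thesis by (simp add: charge_density_def)
  qed
  have int: "integral {a..b} ?\<rho> = (\<Sum>\<alpha>=1..N. e \<alpha> * moment \<alpha> L (\<lambda>_. 1) a b t)" for a b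
    unfolding \<rho>
    by (subst integral_sum) (auto simp: moment_eq_integral t
        intro!: integrable_continuous_real continuous_intros continuous_on_velocity_moment t)
  have "(LBINT y:{..x}. ?\<rho> y) = integral {-R..x} ?\<rho>" "(LBINT y:{x..}. ?\<rho> y) = integral {x..R} ?\<rho>"
    using x by (auto intro!: LBINT_eq_integral_Icc cont zero)
  moreover have "E1 t x = 1/2 * (LBINT y:{..x}. ?\<rho> y) - 1/2 * (LBINT y:{x..}. ?\<rho> y)"
    using solution t unfolding RVM_solution_def by blast
  ultimately show ?thesis
    unfolding int by (simp add: sum_subtractf sum_divide_distrib right_diff_distrib diff_divide_distrib)
qed

text \<open>
  Charge conservation: the charge to the left of \<open>x\<close> decreases at the rate \<open>j\<^sub>1\<close>, and the charge to the right of it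
  increases at the same rate.
\<close>
lemma E1_time_derivative:
  assumes t: "0 \<le> t" "t \<le> T" and R: "C0 + T \<le> R" and x: "\<bar>x\<bar> \<le> R" and L: "0 \<le> L"
    and supp: "\<And>\<alpha> t x v. \<alpha> \<in> {1..N} \<Longrightarrow> 0 \<le> t \<Longrightarrow> t \<le> T \<Longrightarrow> L \<le> norm v \<Longrightarrow> f \<alpha> t x v = 0"
  shows "((\<lambda>s. E1 s x) has_real_derivative - current1 L t x) (at t within {0..T})"
proof -
  let ?J = "\<lambda>\<alpha>. velocity_moment \<alpha> L (\<lambda>v. fst (vhat (m \<alpha>) v)) t"
  have M: "(moment \<alpha> L (\<lambda>_. 1) a b has_real_derivative - (?J \<alpha> b - ?J \<alpha> a)) (at t within {0..T})"
    if "\<alpha> \<in> {1..N}" "a \<le> b" for \<alpha> a b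
    using moment_derivative[where \<psi> = "\<lambda>_. 1" and \<psi>' = "\<lambda>_. 0" and L = L and T = T, OF that(1) t L that(2) supp[OF that(1) t]]
    by simp
  have edge: "?J \<alpha> y = 0" if "\<alpha> \<in> {1..N}" "\<bar>y\<bar> = R" for \<alpha> y
    using f_zero_outside_cone[OF that(1) t(1), of y] that(2) R t(2) by (simp add: velocity_moment_def)
  have "((\<lambda>s. \<Sum>\<alpha>=1..N. e \<alpha> / 2 * (moment \<alpha> L (\<lambda>_. 1) (-R) x s - moment \<alpha> L (\<lambda>_. 1) x R s))
      has_real_derivative (\<Sum>\<alpha>=1..N. e \<alpha> / 2 * (- (?J \<alpha> x - ?J \<alpha> (-R)) - - (?J \<alpha> R - ?J \<alpha> x)))) (at t within {0..T})"
    using x by (intro DERIV_sum DERIV_cmult DERIV_diff M) auto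
  also have "(\<Sum>\<alpha>=1..N. e \<alpha> / 2 * (- (?J \<alpha> x - ?J \<alpha> (-R)) - - (?J \<alpha> R - ?J \<alpha> x))) = - current1 L t x"
    unfolding current1_def sum_negf[symmetric] using x by (intro sum.cong) (simp_all add: edge)
  finally show ?thesis
  proof (rule has_field_derivative_transform_within[OF _ zero_less_one])
    fix s assume "s \<in> {0..T}"
    then show "(\<Sum>\<alpha>=1..N. e \<alpha> / 2 * (moment \<alpha> L (\<lambda>_. 1) (-R) x s - moment \<alpha> L (\<lambda>_. 1) x R s)) = E1 s x"
      using R x supp by (intro E1_eq[symmetric]) auto
  qed (use t in auto)
qed

definition energy :: "real \<Rightarrow> real \<Rightarrow> real \<Rightarrow> real" where
  "energy L R t = (\<Sum>\<alpha>=1..N. moment \<alpha> L (particle_energy (m \<alpha>)) (-R) R t)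
     + 1/2 * integral {-R..R} (\<lambda>x. (E1 t x)\<^sup>2 + (E2 t x)\<^sup>2 + (B t x)\<^sup>2)"

text \<open>
  The work \<open>j \<bullet> E\<close> done on the particles cancels the loss of the fields. What remains is the derivative of the energy flux
  \<open>E2 B\<close>, which integrates to zero since the fields vanish at \<open>\<plusminus>R\<close>. Three facts enter: \<open>particle_energy_derivative\<close> in the
  balance law for the kinetic energy, \<open>\<partial>\<^sub>t E1 = - j\<^sub>1\<close>, and the two remaining Maxwell equations.
\<close>
lemma energy_derivative_zero:
  assumes t: "0 \<le> t" "t \<le> T" and T: "0 < T" and R: "C0 + T \<le> R" and L: "0 \<le> L"
    and supp: "\<And>\<alpha> t x v. \<alpha> \<in> {1..N} \<Longrightarrow> 0 \<le> t \<Longrightarrow> t \<le> T \<Longrightarrow> L \<le> norm v \<Longrightarrow> f \<alpha> t x v = 0"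
  shows "(energy L R has_real_derivative 0) (at t within {0..T})"
proof -
  let ?DE1 = "half_deriv (\<lambda>(t, x). E1 t x)" and ?DE = "half_deriv (\<lambda>(t, x). E2 t x)"
    and ?DB = "half_deriv (\<lambda>(t, x). B t x)"
  have R0: "0 \<le> R" using R T C0_pos by simp
  have ccur: "continuous_on S (current1 L t)" "continuous_on S (current2 L t)" for S
    unfolding current1_def current2_def
    by (intro continuous_intros continuous_on_velocity_moment continuous_on_vhat mass t; simp)+
  note cE = continuous_on_fields[OF t(1)]
  have cD: "continuous_on S (\<lambda>x. half_deriv G (t, x) k)" if "C1_on ({0..} \<times> UNIV) G"
    for S and G :: "real \<times> real \<Rightarrow> real" and k
    using t by (intro continuous_on_half_deriv[OF that] continuous_intros) auto
  have kin: "(moment \<alpha> L (particle_energy (m \<alpha>)) (-R) R has_real_derivative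
      integral {-R..R} (\<lambda>x. e \<alpha> * (E1 t x * velocity_moment \<alpha> L (\<lambda>v. fst (vhat (m \<alpha>) v)) t x
        + E2 t x * velocity_moment \<alpha> L (\<lambda>v. snd (vhat (m \<alpha>) v)) t x))) (at t within {0..T})"
    if \<alpha>: "\<alpha> \<in> {1..N}" for \<alpha>
  proof -
    note m = mass[OF \<alpha>]
    let ?V = "vhat (m \<alpha>)"
    have "(moment \<alpha> L (particle_energy (m \<alpha>)) (-R) R has_real_derivative
        integral (cbox (-R, -L, -L) (R, L, L)) (\<lambda>z. f \<alpha> t (fst z) (snd z) * (force \<alpha> t (fst z) (snd z) \<bullet> ?V (snd z)))
        - (velocity_moment \<alpha> L (\<lambda>v. fst (?V v) * particle_energy (m \<alpha>) v) t R
         - velocity_moment \<alpha> L (\<lambda>v. fst (?V v) * particle_energy (m \<alpha>) v) t (-R))) (at t within {0..T})"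
      using R0 by (intro moment_derivative[OF \<alpha> t L _ supp[OF \<alpha> t]] particle_energy_derivative m
          continuous_on_vhat continuous_on_particle_energy continuous_on_id) auto
    moreover have "velocity_moment \<alpha> L \<psi> t y = 0" if "\<bar>y\<bar> = R" for \<psi> y
      using f_zero_outside_cone[OF \<alpha> t(1), of y] that R t(2) by (simp add: velocity_moment_def)
    moreover have "integral (cbox (-R, -L, -L) (R, L, L)) (\<lambda>z. f \<alpha> t (fst z) (snd z) * (force \<alpha> t (fst z) (snd z) \<bullet> ?V (snd z)))
      = integral (cbox (-R) R) (\<lambda>x. integral (cbox (-L, -L) (L, L)) (\<lambda>v. f \<alpha> t x v * (force \<alpha> t x v \<bullet> ?V v)))"
      using t by (subst integral_prod_continuous)
        (auto intro!: continuous_intros continuous_on_f[OF \<alpha>] continuous_on_force[OF \<alpha>] continuous_on_vhat[OF m])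
    moreover have "integral (cbox (-L, -L) (L, L)) (\<lambda>v. f \<alpha> t x v * (force \<alpha> t x v \<bullet> ?V v))
      = e \<alpha> * (E1 t x * velocity_moment \<alpha> L (\<lambda>v. fst (?V v)) t x + E2 t x * velocity_moment \<alpha> L (\<lambda>v. snd (?V v)) t x)" for x
    proof -
      \<comment> \<open>The magnetic part of the force is orthogonal to the velocity.\<close>
      have eq: "(\<lambda>v. f \<alpha> t x v * (force \<alpha> t x v \<bullet> ?V v)) =
          (\<lambda>v. (e \<alpha> * E1 t x) * (f \<alpha> t x v * fst (?V v)) + (e \<alpha> * E2 t x) * (f \<alpha> t x v * snd (?V v)))"
        by (simp add: force_def inner_prod_def algebra_simps)
      have "integral (cbox (-L, -L) (L, L)) (\<lambda>v. f \<alpha> t x v * (force \<alpha> t x v \<bullet> ?V v)) = (e \<alpha> * E1 t x) * velocity_moment \<alpha> L (\<lambda>v. fst (?V v)) t x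
          + (e \<alpha> * E2 t x) * velocity_moment \<alpha> L (\<lambda>v. snd (?V v)) t x"
        unfolding velocity_moment_def eq
        by (subst Henstock_Kurzweil_Integration.integral_add)
           (auto intro!: integrable_continuous continuous_intros continuous_on_f_slice[OF \<alpha> t(1)] continuous_on_vhat[OF m])
      then show ?thesis by (simp only: distrib_left mult.assoc)
    qed
    ultimately show ?thesis using R0 by simp
  qed
  have kinetic: "((\<lambda>s. \<Sum>\<alpha>=1..N. moment \<alpha> L (particle_energy (m \<alpha>)) (-R) R s) has_real_derivative
      integral {-R..R} (\<lambda>x. E1 t x * current1 L t x + E2 t x * current2 L t x)) (at t within {0..T})"
  proof -
    have "((\<lambda>s. \<Sum>\<alpha>=1..N. moment \<alpha> L (particle_energy (m \<alpha>)) (-R) R s) has_real_derivative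
      (\<Sum>\<alpha>=1..N. integral {-R..R} (\<lambda>x. e \<alpha> * (E1 t x * velocity_moment \<alpha> L (\<lambda>v. fst (vhat (m \<alpha>) v)) t x
        + E2 t x * velocity_moment \<alpha> L (\<lambda>v. snd (vhat (m \<alpha>) v)) t x)))) (at t within {0..T})"
      by (intro DERIV_sum kin)
    also have "(\<Sum>\<alpha>=1..N. integral {-R..R} (\<lambda>x. e \<alpha> * (E1 t x * velocity_moment \<alpha> L (\<lambda>v. fst (vhat (m \<alpha>) v)) t x
        + E2 t x * velocity_moment \<alpha> L (\<lambda>v. snd (vhat (m \<alpha>) v)) t x))) =
      integral {-R..R} (\<lambda>x. \<Sum>\<alpha>=1..N. e \<alpha> * (E1 t x * velocity_moment \<alpha> L (\<lambda>v. fst (vhat (m \<alpha>) v)) t x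
        + E2 t x * velocity_moment \<alpha> L (\<lambda>v. snd (vhat (m \<alpha>) v)) t x))"
      by (rule integral_sum[symmetric])
         (auto intro!: integrable_continuous_real continuous_intros cE continuous_on_velocity_moment
            continuous_on_vhat mass t)
    also have "(\<lambda>x. \<Sum>\<alpha>=1..N. e \<alpha> * (E1 t x * velocity_moment \<alpha> L (\<lambda>v. fst (vhat (m \<alpha>) v)) t x
        + E2 t x * velocity_moment \<alpha> L (\<lambda>v. snd (vhat (m \<alpha>) v)) t x)) =
        (\<lambda>x. E1 t x * current1 L t x + E2 t x * current2 L t x)"
      by (simp add: current1_def current2_def sum_distrib_left sum.distrib distrib_left mult.left_commute)
    finally show ?thesis .
  qed
  have field: "((\<lambda>s. integral {-R..R} (\<lambda>x. (E1 s x)\<^sup>2 + (E2 s x)\<^sup>2 + (B s x)\<^sup>2)) has_real_derivative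
      integral {-R..R} (\<lambda>x. 2 * (E1 t x * ?DE1 (t, x) (1, 0) + E2 t x * ?DE (t, x) (1, 0) + B t x * ?DB (t, x) (1, 0))))
      (at t within {0..T})"
  proof -
    have "((\<lambda>s. integral (cbox (-R) R) (\<lambda>x. (E1 s x)\<^sup>2 + (E2 s x)\<^sup>2 + (B s x)\<^sup>2)) has_field_derivative
      integral (cbox (-R) R) (\<lambda>x. 2 * (E1 t x * ?DE1 (t, x) (1, 0) + E2 t x * ?DE (t, x) (1, 0) + B t x * ?DB (t, x) (1, 0))))
      (at t within {0..T})"
    proof (rule leibniz_rule_field_derivative)
      show "continuous_on ({0..T} \<times> cbox (-R) R)
          (\<lambda>(s, x). 2 * (E1 s x * ?DE1 (s, x) (1, 0) + E2 s x * ?DE (s, x) (1, 0) + B s x * ?DB (s, x) (1, 0)))"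
        by (rule continuous_on_eq[where f = "\<lambda>p. 2 * (E1 (fst p) (snd p) * ?DE1 p (1, 0)
               + E2 (fst p) (snd p) * ?DE p (1, 0) + B (fst p) (snd p) * ?DB p (1, 0))"])
           (auto intro!: continuous_on_add continuous_on_mult continuous_on_const continuous_on_fst continuous_on_snd
              continuous_on_id continuous_on_field[OF C1_E1] continuous_on_field[OF C1_E2]
              continuous_on_field[OF C1_B] continuous_on_half_deriv[OF C1_E1] continuous_on_half_deriv[OF C1_E2]
              continuous_on_half_deriv[OF C1_B])
      show "(\<lambda>x. (E1 s x)\<^sup>2 + (E2 s x)\<^sup>2 + (B s x)\<^sup>2) integrable_on cbox (-R) R" if "s \<in> {0..T}" for s
        using that by (intro integrable_continuous continuous_intros continuous_on_field[OF C1_E1]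
            continuous_on_field[OF C1_E2] continuous_on_field[OF C1_B]) auto
      fix s x assume "s \<in> {0..T}"
      then have s: "0 \<le> s" and sub: "{0..T} \<subseteq> {0..}" by auto
      show "((\<lambda>s. (E1 s x)\<^sup>2 + (E2 s x)\<^sup>2 + (B s x)\<^sup>2) has_real_derivative
          2 * (E1 s x * ?DE1 (s, x) (1, 0) + E2 s x * ?DE (s, x) (1, 0) + B s x * ?DB (s, x) (1, 0)))
          (at s within {0..T})"
        using has_field_derivative_subset[OF field_partials(1)[OF C1_E1 s, of x] sub]
          has_field_derivative_subset[OF field_partials(1)[OF C1_E2 s, of x] sub]
          has_field_derivative_subset[OF field_partials(1)[OF C1_B s, of x] sub]
        by (auto intro!: derivative_eq_intros simp: algebra_simps)
    qed (use t in auto)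
    then show ?thesis by simp
  qed
  have dE1: "?DE1 (t, x) (1, 0) = - current1 L t x" if "\<bar>x\<bar> \<le> R" for x
  proof (rule has_field_derivative_unique)
    show "((\<lambda>s. E1 s x) has_real_derivative ?DE1 (t, x) (1, 0)) (at t within {0..T})"
      using has_field_derivative_subset[OF field_partials(1)[OF C1_E1 t(1), of x]] by auto
    show "((\<lambda>s. E1 s x) has_real_derivative - current1 L t x) (at t within {0..T})"
      using E1_time_derivative[OF t R that L supp] by simp
    show "at t within {0..T} \<noteq> bot" using t T by (simp add: trivial_limit_within islimpt_Icc)
  qed
  have "(energy L R has_real_derivative
      integral {-R..R} (\<lambda>x. E1 t x * current1 L t x + E2 t x * current2 L t x)
      + 1/2 * integral {-R..R} (\<lambda>x. 2 * (E1 t x * ?DE1 (t, x) (1, 0) + E2 t x * ?DE (t, x) (1, 0) + B t x * ?DB (t, x) (1, 0))))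
      (at t within {0..T})"
    unfolding energy_def[abs_def] by (intro DERIV_add DERIV_cmult kinetic field)
  also have "integral {-R..R} (\<lambda>x. E1 t x * current1 L t x + E2 t x * current2 L t x)
      + 1/2 * integral {-R..R} (\<lambda>x. 2 * (E1 t x * ?DE1 (t, x) (1, 0) + E2 t x * ?DE (t, x) (1, 0) + B t x * ?DB (t, x) (1, 0)))
    = integral {-R..R} (\<lambda>x. E1 t x * current1 L t x + E2 t x * current2 L t x)
      + integral {-R..R} (\<lambda>x. E1 t x * ?DE1 (t, x) (1, 0) + E2 t x * ?DE (t, x) (1, 0) + B t x * ?DB (t, x) (1, 0))"
    unfolding integral_mult_right by simp
  also have "\<dots> = integral {-R..R} (\<lambda>x. (E1 t x * current1 L t x + E2 t x * current2 L t x)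
      + (E1 t x * ?DE1 (t, x) (1, 0) + E2 t x * ?DE (t, x) (1, 0) + B t x * ?DB (t, x) (1, 0)))"
    by (rule Henstock_Kurzweil_Integration.integral_add[symmetric])
       (intro integrable_continuous_real continuous_on_add continuous_on_mult cE ccur cD C1_E1 C1_E2 C1_B)+
  also have "\<dots> = integral {-R..R} (\<lambda>x. - (E2 t x * ?DB (t, x) (0, 1) + B t x * ?DE (t, x) (0, 1)))"
  proof (rule integral_cong)
    fix x assume "x \<in> {-R..R}"
    then have "\<bar>x\<bar> \<le> R" by auto
    moreover have "snd (current_density N m e f t x) = current2 L t x"
      by (rule current_density_eq[OF t(1) supp[OF _ t]])
    ultimately show "(E1 t x * current1 L t x + E2 t x * current2 L t x)
      + (E1 t x * ?DE1 (t, x) (1, 0) + E2 t x * ?DE (t, x) (1, 0) + B t x * ?DB (t, x) (1, 0))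
      = - (E2 t x * ?DB (t, x) (0, 1) + B t x * ?DE (t, x) (0, 1))"
      by (simp only: dE1 maxwell[OF t(1)]) (simp add: algebra_simps)
  qed
  also have "\<dots> = - (E2 t R * B t R) - (- (E2 t (-R) * B t (-R)))"
  proof (intro integral_unique fundamental_theorem_of_calculus)
    fix x
    have "((\<lambda>x. - (E2 t x * B t x)) has_real_derivative
        - (E2 t x * ?DB (t, x) (0, 1) + B t x * ?DE (t, x) (0, 1))) (at x)"
      using field_partials(2)[OF C1_E2 t(1), of x] field_partials(2)[OF C1_B t(1), of x]
      by (auto intro!: derivative_eq_intros simp: algebra_simps)
    then show "((\<lambda>x. - (E2 t x * B t x)) has_vector_derivative
        - (E2 t x * ?DB (t, x) (0, 1) + B t x * ?DE (t, x) (0, 1))) (at x within {-R..R})"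
      by (simp add: has_real_derivative_iff_has_vector_derivative has_vector_derivative_at_within)
  qed (use R0 in simp)
  also have "\<dots> = 0"
    using fields_zero_outside_cone[OF t(1), of R] fields_zero_outside_cone[OF t(1), of "-R"] R t R0 by simp
  finally show ?thesis .
qed

lemma energy_conserved:
  assumes T: "0 \<le> T" and R: "C0 + T \<le> R" and L: "0 \<le> L"
    and supp: "\<And>\<alpha> t x v. \<alpha> \<in> {1..N} \<Longrightarrow> 0 \<le> t \<Longrightarrow> t \<le> T \<Longrightarrow> L \<le> norm v \<Longrightarrow> f \<alpha> t x v = 0"
  shows "energy L R T = energy L R 0"
proof (cases "T = 0")
  case False
  then have "(energy L R has_real_derivative 0) (at t within {0..T})" if "t \<in> {0..T}" for t
    using that T by (intro energy_derivative_zero R L supp) auto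
  then obtain c where "\<And>t. t \<in> {0..T} \<Longrightarrow> energy L R t = c"
    using has_field_derivative_zero_constant[of "{0..T}" "energy L R"] by auto
  then show ?thesis using T by simp
qed simp

section \<open>The initial energy and the momentum bound\<close>

text \<open>
  The radius \<open>L\<close> may depend on the solution and on time; replacing it by the radius \<open>L0\<close> of the initial support makes
  the value depend on the data alone.
\<close>
lemma initial_moment_eq:
  assumes \<alpha>: "\<alpha> \<in> {1..N}" and R: "C0 \<le> R"
    and L0: "\<And>x v. f0 \<alpha> x v \<noteq> 0 \<Longrightarrow> norm v \<le> L0"
    and supp: "\<And>x v. L \<le> norm v \<Longrightarrow> f \<alpha> 0 x v = 0"
  shows "moment \<alpha> L \<psi> (-R) R 0 =
    integral (cbox (-C0, -L0, -L0) (C0, L0, L0)) (\<lambda>z. f0 \<alpha> (fst z) (snd z) * \<psi> (snd z))"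
  unfolding moment_def initial_values(1)[OF \<alpha>]
proof (rule integral_eq_of_zero_outside)
  fix z :: "real \<times> real \<times> real" assume *: "z \<notin> cbox (-C0, -L0, -L0) (C0, L0, L0)"
  obtain x v1 v2 where z: "z = (x, v1, v2)" by (cases z)
  have "C0 \<le> \<bar>x\<bar> \<or> (v1, v2) \<notin> cbox (-L0, -L0) (L0, L0)" using * by (auto simp: z)
  then have "f0 \<alpha> x (v1, v2) = 0"
  proof
    assume "(v1, v2) \<notin> cbox (-L0, -L0) (L0, L0)"
    from le_norm_outside_cbox(2)[OF this] show ?thesis using L0[of x "(v1, v2)"] by linarith
  qed (rule data_zero(1)[OF _ \<alpha>])
  then show "f0 \<alpha> (fst z) (snd z) * \<psi> (snd z) = 0" by (simp add: z)
next
  fix z :: "real \<times> real \<times> real" assume *: "z \<notin> cbox (-R, -L, -L) (R, L, L)"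
  obtain x v1 v2 where z: "z = (x, v1, v2)" by (cases z)
  have "C0 \<le> \<bar>x\<bar> \<or> (v1, v2) \<notin> cbox (-L, -L) (L, L)" using * R by (auto simp: z)
  then have "f0 \<alpha> x (v1, v2) = 0"
  proof
    assume "(v1, v2) \<notin> cbox (-L, -L) (L, L)"
    from supp[OF le_norm_outside_cbox(1)[OF this], of x] show ?thesis by (simp add: initial_values(1)[OF \<alpha>])
  qed (rule data_zero(1)[OF _ \<alpha>])
  then show "f0 \<alpha> (fst z) (snd z) * \<psi> (snd z) = 0" by (simp add: z)
qed

lemma initial_E1_bound:
  assumes R: "C0 \<le> R" and x: "\<bar>x\<bar> \<le> R"
    and L0: "\<And>\<alpha> x v. \<alpha> \<in> {1..N} \<Longrightarrow> f0 \<alpha> x v \<noteq> 0 \<Longrightarrow> norm v \<le> L0"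
    and supp: "\<And>\<alpha> x v. \<alpha> \<in> {1..N} \<Longrightarrow> L \<le> norm v \<Longrightarrow> f \<alpha> 0 x v = 0"
  shows "\<bar>E1 0 x\<bar> \<le> data_field_bound N e f0 C0 L0"
proof -
  have M: "0 \<le> moment \<alpha> L (\<lambda>_. 1) a b 0" "moment \<alpha> L (\<lambda>_. 1) a b 0 \<le> data_mass f0 C0 L0 \<alpha>"
    if "\<alpha> \<in> {1..N}" "-R \<le> a" "b \<le> R" for \<alpha> a b
  proof -
    show "0 \<le> moment \<alpha> L (\<lambda>_. 1) a b 0" using that by (intro moment_nonneg) auto
    have "moment \<alpha> L (\<lambda>_. 1) a b 0 \<le> moment \<alpha> L (\<lambda>_. 1) (-R) R 0"
      unfolding moment_def using that
      by (intro integral_subset_le integrable_continuous continuous_intros continuous_on_f[OF that(1)])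
         (auto simp: f_nonneg)
    also have "\<dots> = data_mass f0 C0 L0 \<alpha>"
      by (subst initial_moment_eq[OF that(1) R L0[OF that(1)] supp[OF that(1)]]) (simp_all add: data_mass_def)
    finally show "moment \<alpha> L (\<lambda>_. 1) a b 0 \<le> data_mass f0 C0 L0 \<alpha>" .
  qed
  have xs: "x \<le> R" "-R \<le> x" using x by auto
  have "\<bar>E1 0 x\<bar> = \<bar>\<Sum>\<alpha>=1..N. e \<alpha> / 2 * (moment \<alpha> L (\<lambda>_. 1) (-R) x 0 - moment \<alpha> L (\<lambda>_. 1) x R 0)\<bar>"
    using E1_eq[of 0 R x L] R x supp by simp
  also have "\<dots> \<le> (\<Sum>\<alpha>=1..N. \<bar>e \<alpha> / 2 * (moment \<alpha> L (\<lambda>_. 1) (-R) x 0 - moment \<alpha> L (\<lambda>_. 1) x R 0)\<bar>)"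
    by (rule sum_abs)
  also have "\<dots> \<le> data_field_bound N e f0 C0 L0"
    unfolding data_field_bound_def
  proof (rule sum_mono)
    fix \<alpha> assume \<alpha>: "\<alpha> \<in> {1..N}"
    have "\<bar>moment \<alpha> L (\<lambda>_. 1) (-R) x 0 - moment \<alpha> L (\<lambda>_. 1) x R 0\<bar> \<le> data_mass f0 C0 L0 \<alpha>"
      using M[OF \<alpha> order_refl xs(1)] M[OF \<alpha> xs(2) order_refl] by linarith
    then show "\<bar>e \<alpha> / 2 * (moment \<alpha> L (\<lambda>_. 1) (-R) x 0 - moment \<alpha> L (\<lambda>_. 1) x R 0)\<bar>
        \<le> \<bar>e \<alpha>\<bar> / 2 * data_mass f0 C0 L0 \<alpha>"
      by (simp add: abs_mult mult_left_mono)
  qed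
  finally show ?thesis .
qed

text \<open>
  All charge lies on one side of \<open>x\<close>, and the total charge is zero.
\<close>
lemma initial_E1_neutral:
  assumes "neutral_data N e f0" and x: "C0 \<le> \<bar>x\<bar>"
  shows "E1 0 x = 0"
proof -
  let ?\<rho> = "charge_density N e f 0"
  have \<rho>: "?\<rho> y = (\<integral>v. (\<Sum>\<alpha>=1..N. e \<alpha> * f0 \<alpha> y v) \<partial>lborel)" for y
    unfolding charge_density_def using initial_values(1) by (intro Bochner_Integration.integral_cong sum.cong) auto
  have zero: "?\<rho> y = 0" if "C0 \<le> \<bar>y\<bar>" for y
  proof -
    have "(\<Sum>\<alpha>=1..N. e \<alpha> * f0 \<alpha> y v) = 0" for v
      using data_zero(1)[OF that] by (intro sum.neutral) auto
    then show ?thesis by (simp add: \<rho>)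
  qed
  have total: "(\<integral>y. ?\<rho> y \<partial>lborel) = 0"
    using assms(1) by (simp add: neutral_data_def \<rho>)
  have all: "(LBINT y:S. ?\<rho> y) = 0" if "\<And>y. y \<notin> S \<Longrightarrow> C0 \<le> \<bar>y\<bar>" for S
  proof -
    have "(LBINT y:S. ?\<rho> y) = (\<integral>y. ?\<rho> y \<partial>lborel)"
      unfolding set_lebesgue_integral_def
      by (rule Bochner_Integration.integral_cong) (use that zero in \<open>auto simp: indicator_def\<close>)
    then show ?thesis using total by simp
  qed
  have none: "(LBINT y:S. ?\<rho> y) = 0" if "\<And>y. y \<in> S \<Longrightarrow> C0 \<le> \<bar>y\<bar>" for S
  proof -
    have "(\<lambda>y. indicator S y *\<^sub>R ?\<rho> y) = (\<lambda>y. 0)" using that zero by (auto simp: indicator_def)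
    then show ?thesis unfolding set_lebesgue_integral_def by (simp only: integral_zero)
  qed
  have "(LBINT y:{..x}. ?\<rho> y) = 0 \<and> (LBINT y:{x..}. ?\<rho> y) = 0"
  proof (cases "0 \<le> x")
    case True
    show ?thesis by (intro conjI all none) (use True x in auto)
  next
    case False
    show ?thesis by (rule conjI, rule none, use False x in force, rule all, use False x in force)
  qed
  moreover have "E1 0 x = 1/2 * (LBINT y:{..x}. ?\<rho> y) - 1/2 * (LBINT y:{x..}. ?\<rho> y)"
    using solution unfolding RVM_solution_def by blast
  ultimately show ?thesis by simp
qed

text \<open>
  The radius \<open>l\<close>, beyond which the initial \<open>E1\<close> vanishes on the interval, is what separates the neutral case, with \<open>l = C0\<close>, from the
  monocharge case, with \<open>l = R\<close>.
\<close>
lemma initial_energy_bound: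
  assumes R: "C0 \<le> R" and l: "0 \<le> l" "l \<le> R"
    and E1: "\<And>x. l < \<bar>x\<bar> \<Longrightarrow> \<bar>x\<bar> \<le> R \<Longrightarrow> E1 0 x = 0"
    and L0: "\<And>\<alpha> x v. \<alpha> \<in> {1..N} \<Longrightarrow> f0 \<alpha> x v \<noteq> 0 \<Longrightarrow> norm v \<le> L0"
    and supp: "\<And>\<alpha> x v. \<alpha> \<in> {1..N} \<Longrightarrow> L \<le> norm v \<Longrightarrow> f \<alpha> 0 x v = 0"
  shows "energy L R 0 \<le> data_energy N m f0 E20 B0 C0 L0 + l * (data_field_bound N e f0 C0 L0)\<^sup>2"
proof -
  let ?S = "data_field_bound N e f0 C0 L0"
  note c = continuous_on_fields[of 0, simplified]
  have "integral {-R..R} (\<lambda>x. (E1 0 x)\<^sup>2) = integral {-l..l} (\<lambda>x. (E1 0 x)\<^sup>2)"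
    using E1 l by (intro integral_eq_of_zero_outside) auto
  also have "\<dots> \<le> integral {-l..l} (\<lambda>_. ?S\<^sup>2)"
  proof (rule integral_le)
    fix x assume "x \<in> {-l..l}"
    then have "\<bar>E1 0 x\<bar> \<le> ?S" using l by (intro initial_E1_bound[OF R _ L0 supp]) auto
    then show "(E1 0 x)\<^sup>2 \<le> ?S\<^sup>2" by (metis abs_ge_zero power2_abs power_mono)
  qed (intro integrable_continuous_real continuous_intros c)+
  also have "\<dots> = 2 * l * ?S\<^sup>2" using l by simp
  finally have 1: "integral {-R..R} (\<lambda>x. (E1 0 x)\<^sup>2) \<le> 2 * l * ?S\<^sup>2" .
  have 2: "integral {-R..R} (\<lambda>x. (E2 0 x)\<^sup>2 + (B 0 x)\<^sup>2) = integral {-C0..C0} (\<lambda>x. (E20 x)\<^sup>2 + (B0 x)\<^sup>2)"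
    unfolding initial_values using R by (intro integral_eq_of_zero_outside) (auto simp: data_zero)
  have 3: "integral {-R..R} (\<lambda>x. (E1 0 x)\<^sup>2 + (E2 0 x)\<^sup>2 + (B 0 x)\<^sup>2)
      = integral {-R..R} (\<lambda>x. (E1 0 x)\<^sup>2) + integral {-R..R} (\<lambda>x. (E2 0 x)\<^sup>2 + (B 0 x)\<^sup>2)"
    unfolding add.assoc
    by (intro Henstock_Kurzweil_Integration.integral_add integrable_continuous_real continuous_intros c)
  have 4: "(\<Sum>\<alpha>=1..N. moment \<alpha> L (particle_energy (m \<alpha>)) (-R) R 0) =
      (\<Sum>\<alpha>=1..N. integral (cbox (-C0, -L0, -L0) (C0, L0, L0)) (\<lambda>z. f0 \<alpha> (fst z) (snd z) * particle_energy (m \<alpha>) (snd z)))"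
    by (intro sum.cong refl initial_moment_eq R L0 supp)
  show ?thesis
    unfolding energy_def data_energy_def 3 4 2 using 1 by simp
qed

lemma magnetic_energy_le:
  assumes "0 \<le> t" "0 \<le> R"
  shows "integral {-R..R} (\<lambda>x. (B t x)\<^sup>2) \<le> 2 * energy L R t"
proof -
  have "integral {-R..R} (\<lambda>x. (B t x)\<^sup>2) \<le> integral {-R..R} (\<lambda>x. (E1 t x)\<^sup>2 + (E2 t x)\<^sup>2 + (B t x)\<^sup>2)"
    by (intro integral_le integrable_continuous_real continuous_intros continuous_on_fields assms(1)) auto
  moreover have "0 \<le> (\<Sum>\<alpha>=1..N. moment \<alpha> L (particle_energy (m \<alpha>)) (-R) R t)"
    by (intro sum_nonneg moment_nonneg assms particle_energy_nonneg continuous_on_particle_energy continuous_on_id)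
  ultimately show ?thesis by (simp add: energy_def)
qed

text \<open>
  The radius \<open>L\<close> of the momentum support up to time \<open>t\<close> serves to define the energy and drops out of the estimate,
  which contains only the data.
\<close>
lemma momentum_bound:
  assumes \<alpha>: "\<alpha> \<in> {1..N}" and t: "0 \<le> t" and f: "f \<alpha> t x v \<noteq> 0"
    and l: "0 \<le> l" "l \<le> C0 + t"
    and E1: "\<And>x. l < \<bar>x\<bar> \<Longrightarrow> \<bar>x\<bar> \<le> C0 + t \<Longrightarrow> E1 0 x = 0"
    and L0: "\<And>\<alpha> x v. \<alpha> \<in> {1..N} \<Longrightarrow> f0 \<alpha> x v \<noteq> 0 \<Longrightarrow> norm v \<le> L0"
  shows "\<bar>snd v\<bar> \<le> L0 + 2 * \<bar>e \<alpha>\<bar> * integral {-C0..C0} (\<lambda>y. \<bar>B0 y\<bar>)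
     + \<bar>e \<alpha>\<bar> * sqrt ((C0 + t - \<bar>x\<bar>) *
         (2 * (data_energy N m f0 E20 B0 C0 L0 + l * (data_field_bound N e f0 C0 L0)\<^sup>2)))"
proof -
  let ?M = "integral {-C0..C0} (\<lambda>y. \<bar>B0 y\<bar>)"
  let ?K = "data_energy N m f0 E20 B0 C0 L0 + l * (data_field_bound N e f0 C0 L0)\<^sup>2"
  obtain L where L: "0 < L" "\<And>\<alpha> s x v. \<alpha> \<in> {1..N} \<Longrightarrow> 0 \<le> s \<Longrightarrow> s \<le> t \<Longrightarrow> L \<le> norm v \<Longrightarrow> f \<alpha> s x v = 0"
    using velocity_support_bounded[of t] by metis
  have x: "\<bar>x\<bar> \<le> C0 + t" using f_zero_outside_cone[OF \<alpha> t, of x v] f by linarith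
  have "energy L (C0 + t) t = energy L (C0 + t) 0"
    using t L by (intro energy_conserved) auto
  also have "\<dots> \<le> ?K"
    using t L(2) by (intro initial_energy_bound l E1 L0) auto
  finally have "integral {-(C0 + t)..C0 + t} (\<lambda>y. (B t y)\<^sup>2) \<le> 2 * ?K"
    using magnetic_energy_le[OF t, of "C0 + t" L] t C0_pos by simp
  then have "(C0 + t - \<bar>x\<bar>) * integral {-(C0 + t)..C0 + t} (\<lambda>y. (B t y)\<^sup>2) \<le> (C0 + t - \<bar>x\<bar>) * (2 * ?K)"
    using x by (intro mult_left_mono) auto
  then have "\<bar>potential t x\<bar> \<le> ?M + sqrt ((C0 + t - \<bar>x\<bar>) * (2 * ?K))"
    using potential_bound[OF t x] by (meson add_left_mono order_trans real_sqrt_le_mono)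
  then have "\<bar>e \<alpha> * potential t x\<bar> \<le> \<bar>e \<alpha>\<bar> * (?M + sqrt ((C0 + t - \<bar>x\<bar>) * (2 * ?K)))"
    unfolding abs_mult by (intro mult_left_mono) auto
  then have "\<bar>e \<alpha> * potential t x\<bar> \<le> \<bar>e \<alpha>\<bar> * ?M + \<bar>e \<alpha>\<bar> * sqrt ((C0 + t - \<bar>x\<bar>) * (2 * ?K))"
    by (simp only: distrib_left)
  moreover have "\<bar>snd v + e \<alpha> * potential t x\<bar> \<le> L0 + \<bar>e \<alpha>\<bar> * ?M"
    using canonical_momentum_bound[OF \<alpha> t f L0[OF \<alpha>]] .
  ultimately show ?thesis by linarith
qed

end

text \<open>
  The estimate is a closed condition, so it passes from points where \<open>g\<close> does not vanish to the closure.
\<close>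
lemma phase_support_bound:
  assumes "\<And>t x v. 0 \<le> t \<Longrightarrow> g t x v \<noteq> 0 \<Longrightarrow> \<bar>snd v\<bar> \<le> C + C * sqrt (h t x)"
    and "continuous_on UNIV (\<lambda>(t, x). h t x)"
  shows "\<forall>(t, x, v)\<in>phase_support g. \<bar>snd v\<bar> \<le> C + C * sqrt (h t x)"
proof -
  have "continuous_on UNIV (\<lambda>z. (\<lambda>(t, x). h t x) (fst z, fst (snd z)))"
    by (rule continuous_on_compose2[OF assms(2)]) (auto intro!: continuous_intros)
  then have h: "continuous_on UNIV (\<lambda>z. h (fst z) (fst (snd z)))" by simp
  have "closed {z. \<bar>snd (snd (snd z))\<bar> \<le> C + C * sqrt (h (fst z) (fst (snd z)))}"
    by (intro closed_Collect_le continuous_intros h)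
  then have "phase_support g \<subseteq> {z. \<bar>snd (snd (snd z))\<bar> \<le> C + C * sqrt (h (fst z) (fst (snd z)))}"
    unfolding phase_support_def using assms(1) by (intro closure_minimal) auto
  then show ?thesis by auto
qed

theorem theorem1p2:
  fixes N :: nat
    and m e :: "nat \<Rightarrow> real"
    and f0 :: "nat \<Rightarrow> real \<Rightarrow> real \<times> real \<Rightarrow> real"
    and E20 B0 :: "real \<Rightarrow> real"
    and C0 :: real
  assumes "1 \<le> N"
    and "\<And>\<alpha>. \<alpha> \<in> {1..N} \<Longrightarrow> m \<alpha> > 0"
    and "admissible_data N f0 E20 B0 C0"
  shows "(neutral_data N e f0 \<longrightarrow>
           (\<exists>C. \<forall>f E1 E2 B. RVM_solution N m e f0 E20 B0 f E1 E2 B \<longrightarrow>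
             (\<forall>\<alpha>\<in>{1..N}. \<forall>(t, x, v)\<in>phase_support (f \<alpha>).
                \<bar>snd v\<bar> \<le> C + C * sqrt (t - \<bar>x\<bar> + C0)))) \<and>
         (monocharge N m e \<longrightarrow>
           (\<exists>C>0. \<forall>f E1 E2 B. RVM_solution N m e f0 E20 B0 f E1 E2 B \<longrightarrow>
             (\<forall>(t, x, v)\<in>phase_support (f 1).
                \<bar>snd v\<bar> \<le> C + C * sqrt ((t + C0)\<^sup>2 - x\<^sup>2))))"
proof -
  obtain L where L: "0 < L" "\<And>\<alpha> x v. \<alpha> \<in> {1..N} \<Longrightarrow> f0 \<alpha> x v \<noteq> 0 \<Longrightarrow> norm v \<le> L"
    using initial_velocity_support_bounded[OF assms(3)] by metis
  have C0: "C0 > 0" using assms(3) by (simp add: admissible_data_def)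
  define K where "K = \<bar>data_energy N m f0 E20 B0 C0 L\<bar>"
  define S where "S = (data_field_bound N e f0 C0 L)\<^sup>2"
  define M where "M = \<bar>integral {-C0..C0} (\<lambda>y. \<bar>B0 y\<bar>)\<bar>"
  define q where "q = (\<Sum>\<alpha>=1..N. \<bar>e \<alpha>\<bar>)"
  \<comment> \<open>The term \<open>K / C0\<close> absorbs the fixed energy \<open>K\<close> into a multiple of \<open>C0 + t\<close>.\<close>
  define C where "C = L + 2 * q * M + q * sqrt (2 * (K + C0 * S)) + q * sqrt (2 * (K / C0 + S))"
  have nonneg: "0 \<le> K" "0 \<le> S" "0 \<le> M" "0 \<le> q"
    by (auto simp: K_def S_def M_def q_def intro: sum_nonneg)
  have q: "\<bar>e \<alpha>\<bar> \<le> q" if "\<alpha> \<in> {1..N}" for \<alpha>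
    unfolding q_def using that by (intro member_le_sum) auto
  have terms: "0 \<le> 2 * q * M" "0 \<le> q * sqrt (2 * (K + C0 * S))" "0 \<le> q * sqrt (2 * (K / C0 + S))"
    using nonneg C0 by auto
  have Cpos: "C > 0" unfolding C_def using L(1) terms by linarith
  \<comment> \<open>Here \<open>h\<close> is the radicand of the estimate to be proved, and \<open>c\<close> absorbs the initial energy. The two cases
    differ in these and in the radius \<open>l\<close>, beyond which the initial \<open>E1\<close> vanishes on the interval.\<close>
  have bound: "\<bar>snd v\<bar> \<le> C + C * sqrt h"
    if sol: "RVM_solution N m e f0 E20 B0 f E1 E2 B" and \<alpha>: "\<alpha> \<in> {1..N}" and t: "0 \<le> t" and f: "f \<alpha> t x v \<noteq> 0"
      and l: "0 \<le> l" "l \<le> C0 + t" and E1: "\<And>x. l < \<bar>x\<bar> \<Longrightarrow> \<bar>x\<bar> \<le> C0 + t \<Longrightarrow> E1 0 x = 0"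
      and c: "c = K + C0 * S \<or> c = K / C0 + S" and h: "\<bar>x\<bar> \<le> C0 + t \<Longrightarrow> (C0 + t - \<bar>x\<bar>) * (K + l * S) \<le> h * c" "\<bar>x\<bar> \<le> C0 + t \<Longrightarrow> 0 \<le> h"
    for f E1 E2 B \<alpha> t x v l c h
  proof -
    interpret RVM N m e f0 E20 B0 C0 f E1 E2 B
      by unfold_locales (use assms sol in auto)
    have x: "\<bar>x\<bar> \<le> C0 + t" using f_zero_outside_cone[OF \<alpha> t, of x v] f by linarith
    let ?E = "data_energy N m f0 E20 B0 C0 L + l * (data_field_bound N e f0 C0 L)\<^sup>2"
    have "(C0 + t - \<bar>x\<bar>) * (2 * ?E) \<le> (C0 + t - \<bar>x\<bar>) * (2 * (K + l * S))"
      using x by (intro mult_left_mono) (auto simp: K_def S_def)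
    also have "\<dots> \<le> h * (2 * c)"
      using h(1)[OF x] unfolding mult.left_commute[of _ "2::real"] by linarith
    finally have "sqrt ((C0 + t - \<bar>x\<bar>) * (2 * ?E)) \<le> sqrt h * sqrt (2 * c)"
      by (simp flip: real_sqrt_mult)
    then have "\<bar>e \<alpha>\<bar> * sqrt ((C0 + t - \<bar>x\<bar>) * (2 * ?E)) \<le> \<bar>e \<alpha>\<bar> * (sqrt h * sqrt (2 * c))"
      by (rule mult_left_mono) simp
    also have "\<dots> \<le> q * (sqrt h * sqrt (2 * c))"
      using h(2)[OF x] c nonneg C0 by (intro mult_right_mono q[OF \<alpha>]) auto
    also have "\<dots> \<le> C * sqrt h"
    proof -
      have "q * sqrt (2 * c) \<le> C" using c terms L(1) unfolding C_def by auto
      from mult_right_mono[OF this, of "sqrt h"] h(2)[OF x] show ?thesis by (simp add: mult_ac)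
    qed
    finally have 1: "\<bar>e \<alpha>\<bar> * sqrt ((C0 + t - \<bar>x\<bar>) * (2 * ?E)) \<le> C * sqrt h" .
    have "2 * \<bar>e \<alpha>\<bar> * integral {-C0..C0} (\<lambda>y. \<bar>B0 y\<bar>) \<le> 2 * \<bar>e \<alpha>\<bar> * M"
      by (intro mult_left_mono) (auto simp: M_def)
    also have "\<dots> \<le> 2 * q * M"
      using q[OF \<alpha>] nonneg by (intro mult_right_mono) auto
    finally have 2: "L + 2 * \<bar>e \<alpha>\<bar> * integral {-C0..C0} (\<lambda>y. \<bar>B0 y\<bar>) \<le> C"
      using terms unfolding C_def by linarith
    have "\<bar>snd v\<bar> \<le> L + 2 * \<bar>e \<alpha>\<bar> * integral {-C0..C0} (\<lambda>y. \<bar>B0 y\<bar>)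
        + \<bar>e \<alpha>\<bar> * sqrt ((C0 + t - \<bar>x\<bar>) * (2 * ?E))"
      by (rule momentum_bound[OF \<alpha> t f l E1 L(2)])
    then show ?thesis using 1 2 by linarith
  qed
  show ?thesis
  proof (intro conjI impI)
    assume neutral: "neutral_data N e f0"
    show "\<exists>C. \<forall>f E1 E2 B. RVM_solution N m e f0 E20 B0 f E1 E2 B \<longrightarrow>
        (\<forall>\<alpha>\<in>{1..N}. \<forall>(t, x, v)\<in>phase_support (f \<alpha>). \<bar>snd v\<bar> \<le> C + C * sqrt (t - \<bar>x\<bar> + C0))"
    proof (intro exI[of _ C] allI impI, rule ballI, rule phase_support_bound)
      fix f E1 E2 B \<alpha> t x and v :: "real \<times> real"
      assume sol: "RVM_solution N m e f0 E20 B0 f E1 E2 B" and *: "\<alpha> \<in> {1..N}" "0 \<le> t" "f \<alpha> t x v \<noteq> 0"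
      interpret RVM N m e f0 E20 B0 C0 f E1 E2 B
        by unfold_locales (use assms sol in auto)
      show "\<bar>snd v\<bar> \<le> C + C * sqrt (t - \<bar>x\<bar> + C0)"
        using C0 *(2) by (intro bound[OF sol *, of C0 "K + C0 * S"] initial_E1_neutral[OF neutral])
          (auto simp: algebra_simps)
    qed (auto intro!: continuous_intros simp: split_beta')
  next
    assume "monocharge N m e"
    then have one: "1 \<in> {1..N}" by (simp add: monocharge_def)
    show "\<exists>C>0. \<forall>f E1 E2 B. RVM_solution N m e f0 E20 B0 f E1 E2 B \<longrightarrow>
        (\<forall>(t, x, v)\<in>phase_support (f 1). \<bar>snd v\<bar> \<le> C + C * sqrt ((t + C0)\<^sup>2 - x\<^sup>2))"
    proof (intro exI[of _ C] conjI Cpos allI impI phase_support_bound)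
      fix f E1 E2 B t x and v :: "real \<times> real"
      assume sol: "RVM_solution N m e f0 E20 B0 f E1 E2 B" and *: "0 \<le> t" "f 1 t x v \<noteq> 0"
      have factor: "(t + C0)\<^sup>2 - x\<^sup>2 = (C0 + t - \<bar>x\<bar>) * (C0 + t + \<bar>x\<bar>)"
        by (simp add: power2_eq_square algebra_simps flip: abs_mult)
      show "\<bar>snd v\<bar> \<le> C + C * sqrt ((t + C0)\<^sup>2 - x\<^sup>2)"
      proof (rule bound[OF sol one *, of "C0 + t" "K / C0 + S"])
        assume x: "\<bar>x\<bar> \<le> C0 + t"
        have "K + (C0 + t) * S \<le> (C0 + t) * (K / C0 + S)"
          using nonneg C0 *(1) by (simp add: field_simps)
        also have "\<dots> \<le> (C0 + t + \<bar>x\<bar>) * (K / C0 + S)"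
          using nonneg C0 by (intro mult_right_mono) auto
        finally show "(C0 + t - \<bar>x\<bar>) * (K + (C0 + t) * S) \<le> ((t + C0)\<^sup>2 - x\<^sup>2) * (K / C0 + S)"
          unfolding factor using x by (simp add: mult.assoc mult_left_mono)
        show "0 \<le> (t + C0)\<^sup>2 - x\<^sup>2" unfolding factor using x by simp
      qed (use C0 *(1) in auto)
    qed (auto intro!: continuous_intros simp: split_beta')
  qed
qed

end
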